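(* Let $\mathbb{K}$ be a field of characteristic zero and $n$ a positive integer. (i) For every $d\ge 0$, the homogeneous component $\mathcal{I}_{n,d}$ of degree $d$ of $\mathcal{I}_n$ has as a $\mathbb{K}$-vector space basis the set of all invariants $\mathcal{O}(\mathbf c_1)\cdots\mathcal{O}(\mathbf c_k)$, where each $\mathbf c_i$ is a quasi-connected multigraph on $n$ vertices with $n_i$ non-isolated vertices and $d_i$ edges, and where $n_1+\dots+n_k\le n$ and $d_1+\dots+d_k=d$. (ii) The invariant ring $\mathcal{I}_n$ is generated as a $\mathbb{K}$-algebra by the set of all homogeneous invariants $\mathcal{O}(\mathbf g)$, where $\mathbf g$ is a quasi-connected multigraph on $n$ vertices with at most $\beta(\mathcal{I}_n)$ edges.
   Context: Let $\mathbb{K}[x_{\{i,j\}}]$ be the polynomial ring in $\binom n2$ variables indexed by the pairs $\{i,j\}$, $1\le i<j\le n$. The symmetric group $\mathfrak{S}_n$ acts on it by $\sigma\cdot x_{\{i,j\}}=x_{\{\sigma(i),\sigma(j)\}}$, and $\mathcal{I}_n:=\mathbb{K}[x_{\{i,j\}}]^{\mathfrak{S}_n}$, graded by polynomial degree. A multigraph $\mathbf g$ on $\{1,\dots,n\}$ (undirected, no loops) is a family $(g_{\{i,j\}})$ of non-negative integers (edge multiplicities); its number of edges is $\sum g_{\{i,j\}}$ (counted with multiplicity). A vertex is isolated if all pairs containing it have multiplicity $0$. A multigraph is quasi-connected if it has at most one non-trivial connected component, i.e. at most one connected component not reduced to a single vertex. Write $x^{\mathbf g}:=\prod x_{\{i,j\}}^{g_{\{i,j\}}}$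 and $\mathcal{O}(\mathbf g):=\sum_{\mathbf h}x^{\mathbf h}$, the sum being over all distinct multigraphs $\mathbf h$ in the $\mathfrak{S}_n$-orbit of $\mathbf g$; it depends only on the isomorphism class of $\mathbf g$. $\beta(\mathcal{I}_n)$ denotes the smallest integer $d$ such that $\mathcal{I}_n$ is generated as a $\mathbb{K}$-algebra by its invariants of degree at most $d$. *)

theory Defs
  imports Complex_Main "HOL-Library.Poly_Mapping" "HOL-Combinatorics.Permutations"
begin

definition pairs :: "nat \<Rightarrow> nat set set" where
  "pairs n = {{i, j} | i j. 1 \<le> i \<and> i < j \<and> j \<le> n}"

text \<open>A multigraph is the same thing as the exponent vector of a monomial in the
  variables indexed by pairs: it maps each pair to its multiplicity.\<close>

type_synonym multigraph = "nat set \<Rightarrow>\<^sub>0 nat"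

type_synonym 'k edge_poly = "multigraph \<Rightarrow>\<^sub>0 'k"

definition is_multigraph :: "nat \<Rightarrow> multigraph \<Rightarrow> bool" where
  "is_multigraph n g \<longleftrightarrow> Poly_Mapping.keys g \<subseteq> pairs n"

definition num_edges :: "multigraph \<Rightarrow> nat" where
  "num_edges g = (\<Sum>e\<in>Poly_Mapping.keys g. Poly_Mapping.lookup g e)"

definition isolated :: "nat \<Rightarrow> multigraph \<Rightarrow> nat \<Rightarrow> bool" where
  "isolated n g v \<longleftrightarrow> (\<forall>e\<in>pairs n. v \<in> e \<longrightarrow> Poly_Mapping.lookup g e = 0)"

definition non_isolated_vertices :: "nat \<Rightarrow> multigraph \<Rightarrow> nat set" where
  "non_isolated_vertices n g = {v \<in> {1..n}. \<not> isolated n g v}"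

definition adjacency :: "nat \<Rightarrow> multigraph \<Rightarrow> (nat \<times> nat) set" where
  "adjacency n g = {(u, v). {u, v} \<in> pairs n \<and> Poly_Mapping.lookup g {u, v} > 0}"

definition connected_components :: "nat \<Rightarrow> multigraph \<Rightarrow> nat set set" where
  "connected_components n g = {1..n} // ((adjacency n g)\<^sup>* \<inter> {1..n} \<times> {1..n})"

definition quasi_connected :: "nat \<Rightarrow> multigraph \<Rightarrow> bool" where
  "quasi_connected n g \<longleftrightarrow>
     card {C \<in> connected_components n g. \<not> is_singleton C} \<le> 1"

definition relabel :: "(nat \<Rightarrow> nat) \<Rightarrow> multigraph \<Rightarrow> multigraph" where
  "relabel \<sigma> g = (\<Sum>e\<in>Poly_Mapping.keys g. Poly_Mapping.single (\<sigma> ` e) (Poly_Mapping.lookup g e))"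

text \<open>The polynomial ring in the variables indexed by \<^term>\<open>pairs n\<close>, as a subring of
  the polynomials in variables indexed by all sets of naturals.\<close>

definition poly_ring :: "nat \<Rightarrow> 'k::field edge_poly set" where
  "poly_ring n = {p. \<forall>m\<in>Poly_Mapping.keys p. is_multigraph n m}"

definition perm_act :: "(nat \<Rightarrow> nat) \<Rightarrow> 'k::field edge_poly \<Rightarrow> 'k edge_poly" where
  "perm_act \<sigma> p = (\<Sum>m\<in>Poly_Mapping.keys p. Poly_Mapping.single (relabel \<sigma> m) (Poly_Mapping.lookup p m))"

text \<open>The following lemmas check that \<^const>\<open>perm_act\<close> is the algebra
  endomorphism sending the variable of \<open>e\<close> to the variable of \<open>\<sigma> ` e\<close>.\<close>

lemma perm_act_const: "perm_act \<sigma> (Poly_Mapping.single 0 c) = Poly_Mapping.single 0 c"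
  by (simp add: perm_act_def relabel_def)

lemma perm_act_var:
  "perm_act \<sigma> (Poly_Mapping.single (Poly_Mapping.single e 1) 1) =
     Poly_Mapping.single (Poly_Mapping.single (\<sigma> ` e) 1) 1"
  by (simp add: perm_act_def relabel_def)

lemma relabel_add: "relabel \<sigma> (g + h) = relabel \<sigma> g + relabel \<sigma> h"
  unfolding relabel_def by (rule setsum_keys_plus_distrib) (simp_all add: single_add)

lemma perm_act_add: "perm_act \<sigma> (p + q) = perm_act \<sigma> p + perm_act \<sigma> q"
  unfolding perm_act_def by (rule setsum_keys_plus_distrib) (simp_all add: single_add)

lemma perm_act_single:
  "perm_act \<sigma> (Poly_Mapping.single m c) = Poly_Mapping.single (relabel \<sigma> m) c"
  by (simp add: perm_act_def)

lemma edge_poly_induct [case_names zero single_plus]: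
  assumes "P 0" and "\<And>m c p. P p \<Longrightarrow> P (Poly_Mapping.single m c + p)"
  shows "P (p :: 'k::field edge_poly)"
proof (induction p rule: update_induct)
  case const
  show ?case by (rule assms(1))
next
  case (update p m c)
  have "Poly_Mapping.update m c p = Poly_Mapping.single m c + p"
    using update by (intro poly_mapping_eqI)
      (auto simp: lookup_update lookup_add lookup_single in_keys_iff when_def)
  with update assms(2) show ?case by simp
qed

lemma perm_act_mult: "perm_act \<sigma> (p * q) = perm_act \<sigma> p * perm_act \<sigma> q"
proof (induction p rule: edge_poly_induct)
  case zero
  show ?case by (simp add: perm_act_def)
next
  case (single_plus m c p)
  have "perm_act \<sigma> (Poly_Mapping.single m c * q) =
      perm_act \<sigma> (Poly_Mapping.single m c) * perm_act \<sigma> q"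
  proof (induction q rule: edge_poly_induct)
    case zero
    show ?case by (simp add: perm_act_def)
  next
    case (single_plus m' c' q)
    then show ?case
      by (simp add: mult_single perm_act_single relabel_add perm_act_add distrib_left)
  qed
  with single_plus show ?case by (simp add: perm_act_add distrib_right)
qed

definition invariants :: "nat \<Rightarrow> 'k::field edge_poly set" where
  "invariants n = {p \<in> poly_ring n. \<forall>\<sigma>. \<sigma> permutes {1..n} \<longrightarrow> perm_act \<sigma> p = p}"

definition homogeneous_component :: "nat \<Rightarrow> 'k::field edge_poly set \<Rightarrow> 'k edge_poly set" where
  "homogeneous_component d A = {p \<in> A. \<forall>m\<in>Poly_Mapping.keys p. num_edges m = d}"

definition graph_orbit :: "nat \<Rightarrow> multigraph \<Rightarrow> multigraph set" where
  "graph_orbit n g = {relabel \<sigma> g | \<sigma>. \<sigma> permutes {1..n}}"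

definition orbit_sum :: "nat \<Rightarrow> multigraph \<Rightarrow> 'k::field edge_poly" where
  "orbit_sum n g = (\<Sum>h\<in>graph_orbit n g. Poly_Mapping.single h 1)"

definition poly_scale :: "'k::field \<Rightarrow> 'k edge_poly \<Rightarrow> 'k edge_poly" where
  "poly_scale c p = Poly_Mapping.single 0 c * p"

global_interpretation edge_poly:
  vector_space "poly_scale :: 'k::field \<Rightarrow> 'k edge_poly \<Rightarrow> 'k edge_poly"
  by unfold_locales
    (simp_all add: poly_scale_def algebra_simps single_add mult_single
      flip: mult.assoc)

definition is_subalgebra :: "'k::field edge_poly set \<Rightarrow> bool" where
  "is_subalgebra A \<longleftrightarrow> edge_poly.subspace A \<and> 1 \<in> A \<and> (\<forall>p\<in>A. \<forall>q\<in>A. p * q \<in> A)"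

definition algebra_generated :: "'k::field edge_poly set \<Rightarrow> 'k edge_poly set" where
  "algebra_generated S = is_subalgebra hull S"

definition generation_degree :: "'k::field edge_poly set \<Rightarrow> nat" where
  "generation_degree A = (LEAST d. algebra_generated {p \<in> A. \<forall>m\<in>Poly_Mapping.keys p. num_edges m \<le> d} = A)"

text \<open>The factors may be edgeless (their orbit sum is 1) and the list may be empty;
  neither enlarges the resulting set of polynomials.\<close>

definition orbit_sum_products :: "nat \<Rightarrow> nat \<Rightarrow> 'k::field edge_poly set" where
  "orbit_sum_products n d = {prod_list (map (orbit_sum n) cs) | cs.
     (\<forall>c\<in>set cs. is_multigraph n c \<and> quasi_connected n c) \<and>
     (\<Sum>c\<leftarrow>cs. card (non_isolated_vertices n c)) \<le> n \<and>
     (\<Sum>c\<leftarrow>cs. num_edges c) = d}"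

end

theory Submission
  imports Defs
begin

text \<open>
  Let \<open>P g\<close> be the product of the orbit sums of the connected components of \<open>g\<close>. A monomial of
  \<open>P g\<close> is a superposition of relabelled components of \<open>g\<close>; it has at most as many non-isolated
  vertices as \<open>g\<close>, with equality only if the components stay disjoint, that is, only for monomials in
  the orbit of \<open>g\<close>. All coefficients are natural numbers and that of \<open>g\<close> is positive, so in
  characteristic zero the products \<open>P g\<close> are triangular with respect to the orbit sums. Every product
  in the statement is some \<open>P g\<close>, because the bound on the vertex numbers leaves room to make the
  factors disjoint.

  The second part follows degree by degree, once some degree bound for generators is known: the
  \<open>LEAST\<close> in \<open>generation_degree\<close> is meaningless otherwise. Noether's bound is obtained by Benson's
  argument: for any family \<open>x\<close> indexed by the group, \<open>\<Prod>\<sigma>. (\<tau> \<sigma> x\<^sub>\<sigma> - x\<^sub>\<sigma>)\<close> vanishes for every \<open>\<tau>\<close>, since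
  the factor at the inverse of \<open>\<tau>\<close> does. Expanding and summing over \<open>\<tau>\<close> writes the product of the
  \<open>x\<^sub>\<sigma>\<close>, hence every monomial of large degree, as a combination of monomials of smaller degree whose
  coefficients are invariants of degree at most the group order.
\<close>

abbreviation keys where "keys \<equiv> Poly_Mapping.keys"
abbreviation lookup where "lookup \<equiv> Poly_Mapping.lookup"
abbreviation single where "single \<equiv> Poly_Mapping.single"

section \<open>Relabelling\<close>

text \<open>Natural numbers do not cancel, so superposing graphs unites their edge sets exactly;
  over a ring only the inclusion \<open>keys_add\<close> holds.\<close>

lemma keys_plus_nat: "keys (g + h :: 'a \<Rightarrow>\<^sub>0 nat) = keys g \<union> keys h"
  by (auto simp: in_keys_iff lookup_add)

lemma keys_sum_nat: "finite I \<Longrightarrow> keys (\<Sum>i\<in>I. f i :: 'a \<Rightarrow>\<^sub>0 nat) = (\<Union>i\<in>I. keys (f i))"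
  by (induction I rule: finite_induct) (auto simp: keys_plus_nat)

lemma sum_single_lookup: "(\<Sum>e\<in>keys g. single e (lookup g e)) = g"
  by (rule poly_mapping_eqI)
    (auto simp: lookup_sum lookup_single when_def in_keys_iff sum.delta)

lemma relabel_0 [simp]: "relabel \<sigma> 0 = 0"
  by (simp add: relabel_def)

lemma relabel_single [simp]: "relabel \<sigma> (single e k) = single (\<sigma> ` e) k"
  by (simp add: relabel_def)

lemma relabel_sum: "relabel \<sigma> (\<Sum>i\<in>I. f i) = (\<Sum>i\<in>I. relabel \<sigma> (f i))"
  by (induction I rule: infinite_finite_induct) (auto simp: relabel_add)

lemma relabel_relabel: "relabel \<sigma> (relabel \<tau> g) = relabel (\<sigma> \<circ> \<tau>) g"
  by (simp add: relabel_def[of \<tau>] relabel_sum image_comp) (simp add: relabel_def)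

lemma relabel_id [simp]: "relabel id g = g"
  by (simp add: relabel_def sum_single_lookup)

text \<open>\<open>relabel\<close> adds up the multiplicities of all edges with the same image;
  injectivity excludes such merging.\<close>

lemma lookup_relabel:
  assumes "bij \<sigma>"
  shows "lookup (relabel \<sigma> g) (\<sigma> ` e) = lookup g e"
proof -
  have "\<sigma> ` e' = \<sigma> ` e \<longleftrightarrow> e' = e" for e'
    using assms by (simp add: bij_is_inj inj_image_eq_iff)
  then show ?thesis
    by (auto simp: relabel_def lookup_sum lookup_single when_def in_keys_iff)
qed

lemma keys_relabel:
  assumes "bij \<sigma>"
  shows "keys (relabel \<sigma> g) = image \<sigma> ` keys g"
proof -
  have "e \<in> keys (relabel \<sigma> g) \<longleftrightarrow> e \<in> image \<sigma> ` keys g" for e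
  proof -
    obtain e' where "e = \<sigma> ` e'"
      using assms by (metis bij_is_surj image_f_inv_f)
    with assms show ?thesis
      by (auto simp: in_keys_iff lookup_relabel bij_is_inj inj_image_eq_iff)
  qed
  then show ?thesis by blast
qed

section \<open>Edge numbers and vertex sets of multigraphs\<close>

lemma num_edges_0 [simp]: "num_edges 0 = 0"
  by (simp add: num_edges_def)

lemma num_edges_single [simp]: "num_edges (single e k) = k"
  by (simp add: num_edges_def)

lemma num_edges_plus: "num_edges (g + h) = num_edges g + num_edges h"
  unfolding num_edges_def by (rule setsum_keys_plus_distrib) simp_all

lemma num_edges_sum: "num_edges (\<Sum>i\<in>I. f i) = (\<Sum>i\<in>I. num_edges (f i))"
  by (induction I rule: infinite_finite_induct) (auto simp: num_edges_plus)

lemma num_edges_relabel: "num_edges (relabel \<sigma> g) = num_edges g"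
  by (simp add: relabel_def num_edges_sum) (simp add: num_edges_def)

text \<open>The non-isolated vertices, but without reference to \<open>n\<close> and visibly
  compatible with superposition and relabelling; \<open>non_isolated_vertices_eq_verts\<close> links
  the two notions.\<close>

definition verts :: "multigraph \<Rightarrow> nat set" where
  "verts g = \<Union>(keys g)"

lemma verts_0 [simp]: "verts 0 = {}"
  by (simp add: verts_def)

lemma verts_plus: "verts (g + h) = verts g \<union> verts h"
  by (simp add: verts_def keys_plus_nat)

lemma verts_sum: "finite I \<Longrightarrow> verts (\<Sum>i\<in>I. f i) = (\<Union>i\<in>I. verts (f i))"
  by (auto simp: verts_def keys_sum_nat)

lemma verts_relabel: "bij \<sigma> \<Longrightarrow> verts (relabel \<sigma> g) = \<sigma> ` verts g"
  by (auto simp: verts_def keys_relabel)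

lemma relabel_cong:
  assumes "\<And>x. x \<in> verts g \<Longrightarrow> \<sigma> x = \<tau> x"
  shows "relabel \<sigma> g = relabel \<tau> g"
  unfolding relabel_def
proof (rule sum.cong)
  fix e assume "e \<in> keys g"
  then have "\<sigma> ` e = \<tau> ` e"
    using assms by (auto simp: verts_def intro!: image_cong)
  then show "single (\<sigma> ` e) (lookup g e) = single (\<tau> ` e) (lookup g e)" by simp
qed simp

text \<open>Removes the order of the endpoints, which permutations do not respect.\<close>

lemma pairs_iff: "e \<in> pairs n \<longleftrightarrow> e \<subseteq> {1..n} \<and> card e = 2"
proof
  assume "e \<in> pairs n"
  then show "e \<subseteq> {1..n} \<and> card e = 2" by (auto simp: pairs_def)
next
  assume e: "e \<subseteq> {1..n} \<and> card e = 2"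
  then obtain a b where ab: "e = {a, b}" "a \<noteq> b" by (auto simp: card_2_iff)
  show "e \<in> pairs n"
  proof (cases "a < b")
    case True
    then show ?thesis using e ab by (auto simp: pairs_def)
  next
    case False
    then have "e = {b, a}" "b < a" using ab by auto
    then show ?thesis using e by (auto simp: pairs_def)
  qed
qed

lemma pairs_image: "\<sigma> permutes {1..n} \<Longrightarrow> e \<in> pairs n \<Longrightarrow> \<sigma> ` e \<in> pairs n"
  using permutes_image[of \<sigma> "{1..n}"]
  by (auto simp: pairs_iff card_image permutes_inj inj_on_subset[OF permutes_inj])

lemma is_multigraph_0 [simp]: "is_multigraph n 0"
  by (simp add: is_multigraph_def)

lemma is_multigraph_plus:
  "is_multigraph n (g + h) \<longleftrightarrow> is_multigraph n g \<and> is_multigraph n h"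
  by (auto simp: is_multigraph_def keys_plus_nat)

lemma is_multigraph_sum:
  "finite I \<Longrightarrow> is_multigraph n (\<Sum>i\<in>I. f i) \<longleftrightarrow> (\<forall>i\<in>I. is_multigraph n (f i))"
  by (auto simp: is_multigraph_def keys_sum_nat)

lemma is_multigraph_relabel:
  "\<sigma> permutes {1..n} \<Longrightarrow> is_multigraph n g \<Longrightarrow> is_multigraph n (relabel \<sigma> g)"
  by (auto simp: is_multigraph_def keys_relabel permutes_bij pairs_image)

lemma verts_subset: "is_multigraph n g \<Longrightarrow> verts g \<subseteq> {1..n}"
  unfolding verts_def is_multigraph_def using pairs_iff by blast

lemma finite_verts: "is_multigraph n g \<Longrightarrow> finite (verts g)"
  using verts_subset finite_subset by blast

lemma empty_not_edge: "is_multigraph n g \<Longrightarrow> {} \<notin> keys g"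
  by (auto simp: is_multigraph_def pairs_iff)

lemma non_isolated_vertices_eq_verts:
  assumes "is_multigraph n g"
  shows "non_isolated_vertices n g = verts g"
proof -
  have "v \<in> non_isolated_vertices n g \<longleftrightarrow> v \<in> verts g" for v
  proof -
    have "v \<in> verts g \<longleftrightarrow> (\<exists>e\<in>pairs n. v \<in> e \<and> lookup g e \<noteq> 0)"
      using assms unfolding verts_def is_multigraph_def
      by (simp only: lookup_not_eq_zero_eq_in_keys) blast
    then show ?thesis
      using verts_subset[OF assms] by (auto simp: non_isolated_vertices_def isolated_def)
  qed
  then show ?thesis by blast
qed

text \<open>The complements of \<open>A\<close> and of its image in the finite set \<open>S\<close>
  have equal size, so any bijection between them completes \<open>f\<close>. This turns injections
  defined on vertex sets into elements of the symmetric group.\<close>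

lemma exists_permutes_extending:
  assumes "finite S" "A \<subseteq> S" "inj_on f A" "f ` A \<subseteq> S"
  shows "\<exists>\<sigma>. \<sigma> permutes S \<and> (\<forall>x\<in>A. \<sigma> x = f x)"
proof -
  have "finite A" using assms finite_subset by blast
  then have "card (S - A) = card (S - f ` A)"
    using assms by (simp add: card_Diff_subset card_image)
  then obtain g where g: "bij_betw g (S - A) (S - f ` A)"
    using assms finite_same_card_bij[of "S - A" "S - f ` A"] by auto
  define \<sigma> where "\<sigma> x = (if x \<in> A then f x else if x \<in> S then g x else x)" for x
  have "bij_betw \<sigma> A (f ` A)"
    using assms by (auto simp: \<sigma>_def bij_betw_def inj_on_def)
  moreover have "bij_betw \<sigma> (S - A) (S - f ` A)"
    using g by (subst bij_betw_cong[of _ _ g]) (auto simp: \<sigma>_def)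
  ultimately have "bij_betw \<sigma> (A \<union> (S - A)) (f ` A \<union> (S - f ` A))"
    by (rule bij_betw_combine) auto
  then have "bij_betw \<sigma> S S" using assms by (simp add: Un_absorb1)
  moreover have "\<sigma> x = x" if "x \<notin> S" for x
    using that assms by (auto simp: \<sigma>_def)
  ultimately have "\<sigma> permutes S" by (rule bij_imp_permutes)
  then show ?thesis by (auto simp: \<sigma>_def)
qed

section \<open>Orbits\<close>

lemma graph_orbit_self: "g \<in> graph_orbit n g"
  unfolding graph_orbit_def using permutes_id relabel_id by (metis (mono_tags, lifting) mem_Collect_eq)

lemma finite_graph_orbit [simp]: "finite (graph_orbit n g)"
proof -
  have "graph_orbit n g = (\<lambda>\<sigma>. relabel \<sigma> g) ` {\<sigma>. \<sigma> permutes {1..n}}"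
    by (auto simp: graph_orbit_def)
  then show ?thesis by (simp add: finite_permutations)
qed

lemma relabel_in_graph_orbit:
  assumes "\<sigma> permutes {1..n}" "h \<in> graph_orbit n g"
  shows "relabel \<sigma> h \<in> graph_orbit n g"
  using assms unfolding graph_orbit_def by (auto simp: relabel_relabel intro: permutes_compose)

lemma graph_orbit_sym:
  assumes "h \<in> graph_orbit n g"
  shows "g \<in> graph_orbit n h"
proof -
  obtain \<sigma> where \<sigma>: "\<sigma> permutes {1..n}" "h = relabel \<sigma> g"
    using assms by (auto simp: graph_orbit_def)
  then have "g = relabel (inv \<sigma>) h"
    by (simp add: relabel_relabel permutes_inv_o)
  then show ?thesis using \<sigma> permutes_inv by (auto simp: graph_orbit_def)
qed

lemma graph_orbit_eq: "h \<in> graph_orbit n g \<Longrightarrow> graph_orbit n h = graph_orbit n g"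
proof -
  have "graph_orbit n h \<subseteq> graph_orbit n g" if "h \<in> graph_orbit n g" for g h
    using relabel_in_graph_orbit that by (auto simp: graph_orbit_def[of n h])
  then show "h \<in> graph_orbit n g \<Longrightarrow> graph_orbit n h = graph_orbit n g"
    using graph_orbit_sym by blast
qed

lemma orbit_sum_eq: "h \<in> graph_orbit n g \<Longrightarrow> orbit_sum n h = orbit_sum n g"
  by (simp add: orbit_sum_def graph_orbit_eq)

lemma lookup_orbit_sum: "lookup (orbit_sum n g) m = (if m \<in> graph_orbit n g then 1 else 0)"
  by (auto simp: orbit_sum_def lookup_sum lookup_single when_def)

lemma keys_orbit_sum: "keys (orbit_sum n g :: 'k::field edge_poly) = graph_orbit n g"
  by (auto simp: in_keys_iff lookup_orbit_sum split: if_splits)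

lemma orbit_sum_0 [simp]: "orbit_sum n 0 = 1"
proof -
  have "graph_orbit n 0 = {0}"
    using graph_orbit_self[of 0 n] by (auto simp: graph_orbit_def)
  then show ?thesis by (simp add: orbit_sum_def)
qed

lemma num_edges_graph_orbit: "h \<in> graph_orbit n g \<Longrightarrow> num_edges h = num_edges g"
  by (auto simp: graph_orbit_def num_edges_relabel)

lemma is_multigraph_graph_orbit: "h \<in> graph_orbit n g \<Longrightarrow> is_multigraph n g \<Longrightarrow> is_multigraph n h"
  by (auto simp: graph_orbit_def is_multigraph_relabel)

lemma card_verts_graph_orbit: "h \<in> graph_orbit n g \<Longrightarrow> card (verts h) = card (verts g)"
  by (auto simp: graph_orbit_def verts_relabel permutes_bij card_image inj_on_subset[OF permutes_inj])

section \<open>The ring of invariants\<close>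

lemma perm_act_0 [simp]: "perm_act \<sigma> 0 = 0"
  by (simp add: perm_act_def)

lemma perm_act_1 [simp]: "perm_act \<sigma> 1 = 1"
  using perm_act_const[of \<sigma> 1] by simp

lemma perm_act_sum: "perm_act \<sigma> (\<Sum>i\<in>I. f i) = (\<Sum>i\<in>I. perm_act \<sigma> (f i))"
  by (induction I rule: infinite_finite_induct) (auto simp: perm_act_add)

lemma perm_act_prod: "perm_act \<sigma> (\<Prod>i\<in>I. f i) = (\<Prod>i\<in>I. perm_act \<sigma> (f i))"
  by (induction I rule: infinite_finite_induct) (auto simp: perm_act_mult)

lemma perm_act_scale: "perm_act \<sigma> (poly_scale c p) = poly_scale c (perm_act \<sigma> p)"
  by (simp add: poly_scale_def perm_act_mult perm_act_const)

lemma perm_act_perm_act: "perm_act \<sigma> (perm_act \<tau> p) = perm_act (\<sigma> \<circ> \<tau>) p"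
  by (simp add: perm_act_def[of \<tau>] perm_act_sum perm_act_single relabel_relabel)
    (simp add: perm_act_def)

lemma lookup_perm_act:
  assumes "bij \<sigma>"
  shows "lookup (perm_act \<sigma> p) (relabel \<sigma> m) = lookup p m"
proof -
  have inv: "relabel (inv \<sigma>) (relabel \<sigma> m) = m" for m
    using assms by (simp add: relabel_relabel bij_is_inj)
  have "relabel \<sigma> m' = relabel \<sigma> m \<longleftrightarrow> m' = m" for m'
    using inv by metis
  then show ?thesis
    by (auto simp: perm_act_def lookup_sum lookup_single when_def in_keys_iff)
qed

lemma lookup_invariant:
  assumes "p \<in> invariants n" "h \<in> graph_orbit n g"
  shows "lookup p h = lookup p g"
proof -
  obtain \<sigma> where \<sigma>: "\<sigma> permutes {1..n}" "h = relabel \<sigma> g"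
    using assms by (auto simp: graph_orbit_def)
  then have "perm_act \<sigma> p = p" using assms by (simp add: invariants_def)
  then show ?thesis using lookup_perm_act[of \<sigma> p g] \<sigma> by (simp add: permutes_bij)
qed

lemma keys_scale_subset: "keys (poly_scale c p) \<subseteq> keys p"
  unfolding poly_scale_def using keys_mult[of "single 0 c" p] by (auto split: if_splits)

lemma lookup_scale: "lookup (poly_scale c p) m = c * lookup p m"
proof (induction p rule: edge_poly_induct)
  case zero
  show ?case by (simp add: poly_scale_def)
next
  case (single_plus m' c' p)
  then show ?case
    by (simp add: poly_scale_def distrib_left mult_single lookup_add lookup_single when_def)
qed

lemma poly_ring_is_subalgebra: "is_subalgebra (poly_ring n :: 'k::field edge_poly set)"
  unfolding is_subalgebra_def edge_poly.subspace_def
proof (intro conjI allI ballI)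
  fix p q :: "'k edge_poly" and c
  assume p: "p \<in> poly_ring n"
  then show "poly_scale c p \<in> poly_ring n"
    using keys_scale_subset unfolding poly_ring_def by blast
  assume q: "q \<in> poly_ring n"
  show "p + q \<in> poly_ring n"
    using p q keys_add[of p q] unfolding poly_ring_def by blast
  show "p * q \<in> poly_ring n"
    using p q keys_mult[of p q] unfolding poly_ring_def by (fastforce simp: is_multigraph_plus)
qed (simp_all add: poly_ring_def)

lemma invariants_is_subalgebra: "is_subalgebra (invariants n :: 'k::field edge_poly set)"
  using poly_ring_is_subalgebra[of n, where 'k = 'k]
  by (auto simp: is_subalgebra_def edge_poly.subspace_def invariants_def
      perm_act_add perm_act_mult perm_act_scale)

section \<open>Generated subalgebras, and orbit sums as a spanning set of the invariants\<close>

lemma is_subalgebra_prod: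
  "is_subalgebra A \<Longrightarrow> (\<And>i. i \<in> I \<Longrightarrow> f i \<in> A) \<Longrightarrow> (\<Prod>i\<in>I. f i) \<in> A"
  by (induction I rule: infinite_finite_induct) (auto simp: is_subalgebra_def)

lemma is_subalgebra_algebra_generated: "is_subalgebra (algebra_generated S)"
  unfolding algebra_generated_def
  by (rule hull_in) (auto simp: is_subalgebra_def intro: edge_poly.subspace_Inter)

lemma algebra_generated_minimal: "S \<subseteq> A \<Longrightarrow> is_subalgebra A \<Longrightarrow> algebra_generated S \<subseteq> A"
  unfolding algebra_generated_def by (rule hull_minimal)

lemma algebra_generated_superset: "S \<subseteq> algebra_generated S"
  unfolding algebra_generated_def by (rule hull_subset)

lemma orbit_sum_invariant:
  assumes "is_multigraph n g"
  shows "orbit_sum n g \<in> (invariants n :: 'k::field edge_poly set)"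
proof -
  have "perm_act \<sigma> (orbit_sum n g) = (orbit_sum n g :: 'k edge_poly)" if \<sigma>: "\<sigma> permutes {1..n}" for \<sigma>
  proof -
    have inj: "inj_on (relabel \<sigma>) (graph_orbit n g)"
      by (rule inj_on_inverseI[of _ "relabel (inv \<sigma>)"])
        (use \<sigma> in \<open>simp add: relabel_relabel permutes_inv_o\<close>)
    have "relabel \<sigma> ` graph_orbit n g \<subseteq> graph_orbit n g"
      using relabel_in_graph_orbit \<sigma> by blast
    then have "relabel \<sigma> ` graph_orbit n g = graph_orbit n g"
      using inj by (simp add: endo_inj_surj)
    then have "(\<Sum>h\<in>graph_orbit n g. single (relabel \<sigma> h) (1::'k)) = (\<Sum>h\<in>graph_orbit n g. single h 1)"
      using sum.reindex[OF inj, of "\<lambda>h. single h (1::'k)"] by simp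
    then show ?thesis by (simp add: orbit_sum_def perm_act_sum perm_act_single)
  qed
  moreover have "orbit_sum n g \<in> poly_ring n"
    using assms by (auto simp: poly_ring_def keys_orbit_sum is_multigraph_graph_orbit)
  ultimately show ?thesis by (simp add: invariants_def)
qed

text \<open>An invariant is constant on each orbit, so subtracting the right multiple of one orbit
  sum clears that orbit and shrinks the support. Only orbit sums of monomials of \<open>p\<close>
  occur, so degree bounds on \<open>p\<close> carry over to them.\<close>

lemma invariant_in_span_orbit_sums:
  assumes "p \<in> (invariants n :: 'k::field edge_poly set)"
  shows "p \<in> edge_poly.span (orbit_sum n ` keys p)"
  using assms
proof (induction "card (keys p)" arbitrary: p rule: less_induct)
  case less
  show ?case
  proof (cases "p = 0")
    case True
    then show ?thesis by (simp add: edge_poly.span_zero)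
  next
    case False
    then obtain g where g: "g \<in> keys p" by fastforce
    define q where "q = p - poly_scale (lookup p g) (orbit_sum n g)"
    have "is_multigraph n g" using g less.prems by (auto simp: invariants_def poly_ring_def)
    then have "q \<in> invariants n"
      using less.prems invariants_is_subalgebra[of n, where 'k = 'k] orbit_sum_invariant[of n g]
      unfolding q_def is_subalgebra_def
      by (intro edge_poly.subspace_diff edge_poly.subspace_scale) auto
    have "lookup q m = (if m \<in> graph_orbit n g then 0 else lookup p m)" for m
      using lookup_invariant[OF less.prems, of m g]
      by (simp add: q_def lookup_minus lookup_scale lookup_orbit_sum)
    then have "keys q \<subseteq> keys p - {g}"
      using graph_orbit_self[of g n] by (auto simp: in_keys_iff split: if_splits)
    with g have "keys q \<subset> keys p" by auto
    then have "q \<in> edge_poly.span (orbit_sum n ` keys q)"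
      by (intro less.hyps \<open>q \<in> invariants n\<close> psubset_card_mono) auto
    then have "q \<in> edge_poly.span (orbit_sum n ` keys p)"
      using \<open>keys q \<subset> keys p\<close> by (meson edge_poly.span_mono image_mono psubset_imp_subset subsetD)
    moreover have "poly_scale (lookup p g) (orbit_sum n g) \<in> edge_poly.span (orbit_sum n ` keys p)"
      using g by (intro edge_poly.span_scale edge_poly.span_base) auto
    ultimately have "q + poly_scale (lookup p g) (orbit_sum n g) \<in> edge_poly.span (orbit_sum n ` keys p)"
      by (rule edge_poly.span_add)
    then show ?thesis by (simp add: q_def)
  qed
qed

section \<open>Connected components as edge sets\<close>

text \<open>Connectedness of an edge set, expressed without paths. The empty edge set qualifies,
  just as the edgeless graph is quasi-connected. The empty edge has no vertices and always splits
  off, hence the conditions \<open>{} \<notin> E\<close> below.\<close>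

definition indecomposable :: "'a set set \<Rightarrow> bool" where
  "indecomposable E \<longleftrightarrow> (\<forall>A B. A \<union> B = E \<longrightarrow> \<Union>A \<inter> \<Union>B = {} \<longrightarrow> A = {} \<or> B = {})"

lemma adjacency_multigraph:
  "is_multigraph n g \<Longrightarrow> (u, v) \<in> adjacency n g \<longleftrightarrow> {u, v} \<in> keys g"
  by (auto simp: adjacency_def is_multigraph_def in_keys_iff)

lemma connected_components_eq:
  "connected_components n g = (\<lambda>x. {y \<in> {1..n}. (x, y) \<in> (adjacency n g)\<^sup>*}) ` {1..n}"
  by (auto simp: connected_components_def quotient_def)

text \<open>If the edges split into two vertex-disjoint parts, endpoints chosen from both parts lie
  in the same non-trivial component, but a path cannot leave the vertices of one part.\<close>

lemma quasi_connected_imp_indecomposable: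
  assumes g: "is_multigraph n g" and qc: "quasi_connected n g"
  shows "indecomposable (keys g)"
  unfolding indecomposable_def
proof (intro allI impI, rule ccontr)
  fix A B assume AB: "A \<union> B = keys g" "\<Union>A \<inter> \<Union>B = {}" and "\<not> (A = {} \<or> B = {})"
  then obtain e f where ef: "e \<in> A" "f \<in> B" by blast
  define comp where "comp x = {y \<in> {1..n}. (x, y) \<in> (adjacency n g)\<^sup>*}" for x
  define \<C> where "\<C> = {C \<in> connected_components n g. \<not> is_singleton C}"
  \<comment> \<open>The component of an endpoint of an edge also contains the other endpoint, so it
    is not trivial.\<close>
  have comp: "comp i \<in> \<C>" if e: "e \<in> keys g" "i \<in> e" for e i
  proof -
    have "e \<subseteq> {1..n}" "card e = 2"
      using e g unfolding is_multigraph_def by (meson pairs_iff subsetD)+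
    then obtain j where j: "e = {i, j}" "j \<noteq> i" "i \<in> {1..n}" "j \<in> {1..n}"
      using \<open>i \<in> e\<close> unfolding card_2_iff by (metis insert_iff insert_commute singletonD subsetD)
    then have "(i, j) \<in> adjacency n g" using e adjacency_multigraph[OF g] by simp
    then have "i \<in> comp i" "j \<in> comp i" using j by (auto simp: comp_def)
    then have "\<not> is_singleton (comp i)" using j(2) by (auto simp: is_singleton_def)
    then show ?thesis using j(3) by (auto simp: \<C>_def connected_components_eq comp_def)
  qed
  have "e \<noteq> {}" "f \<noteq> {}" using ef AB(1) empty_not_edge[OF g] by auto
  then obtain i k where ik: "i \<in> e" "k \<in> f" by blast
  have "finite \<C>" by (simp add: \<C>_def connected_components_eq)
  then have "comp i = comp k"
    using qc comp[of e i] comp[of f k] ik ef AB(1)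
    by (auto simp: quasi_connected_def card_le_Suc0_iff_eq \<C>_def)
  moreover have "k \<in> verts g" using ik ef AB(1) by (auto simp: verts_def)
  then have "k \<in> comp k" using verts_subset[OF g] by (auto simp: comp_def)
  ultimately have "(i, k) \<in> (adjacency n g)\<^sup>*" by (auto simp: comp_def)
  \<comment> \<open>Each edge of the path lies in \<open>A\<close> or in \<open>B\<close>; as its
    first endpoint is a vertex of \<open>A\<close>, it lies in \<open>A\<close>.\<close>
  then have "k \<in> \<Union>A"
  proof (induction rule: rtrancl_induct)
    case base
    show ?case using ik ef by blast
  next
    case (step y z)
    then have "{y, z} \<in> A \<union> B" using adjacency_multigraph[OF g] AB(1) by simp
    then show ?case using step.IH AB(2) by blast
  qed
  then show False using ik ef AB(2) by blast
qed

text \<open>The edges reachable from a vertex share no vertex with the other edges. If there is at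
  least one such edge, indecomposability makes them all the edges, so any two non-trivial components
  coincide.\<close>

lemma indecomposable_imp_quasi_connected:
  assumes g: "is_multigraph n g" and ind: "indecomposable (keys g)"
  shows "quasi_connected n g"
proof -
  define R where "R = (adjacency n g)\<^sup>*"
  define comp where "comp x = {y \<in> {1..n}. (x, y) \<in> R}" for x
  have "sym (adjacency n g)"
    by (auto simp: sym_def adjacency_def insert_commute)
  then have "sym R" unfolding R_def by (rule sym_rtrancl)
  \<comment> \<open>A non-trivial component has a second vertex, and the first step of a path to it
    is an edge at \<open>i\<close>.\<close>
  have edge: "\<exists>u. {i, u} \<in> keys g" if i: "i \<in> {1..n}" "\<not> is_singleton (comp i)" for i
  proof -
    have "i \<in> comp i" using i by (simp add: comp_def R_def)
    with i obtain j where "j \<in> comp i" "j \<noteq> i" by (auto simp: is_singleton_def)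
    then obtain u where "(i, u) \<in> adjacency n g"
      by (auto simp: comp_def R_def elim: converse_rtranclE)
    then show ?thesis using adjacency_multigraph[OF g] by auto
  qed
  have eq: "comp i = comp k"
    if i: "i \<in> {1..n}" "\<not> is_singleton (comp i)" and k: "k \<in> {1..n}" "\<not> is_singleton (comp k)" for i k
  proof -
    obtain u w where uw: "{i, u} \<in> keys g" "{k, w} \<in> keys g" using edge i k by blast
    \<comment> \<open>The edges meeting the component of \<open>i\<close>; \<open>reach\<close>
      shows that they then lie inside it.\<close>
    define A where "A = {e \<in> keys g. \<exists>x\<in>e. (i, x) \<in> R}"
    have reach: "(i, y) \<in> R" if "e \<in> A" "y \<in> e" for e y
    proof -
      obtain x where x: "e \<in> keys g" "x \<in> e" "(i, x) \<in> R" using \<open>e \<in> A\<close> by (auto simp: A_def)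
      show ?thesis
      proof (cases "x = y")
        case False
        have "card e = 2" using x(1) g by (meson is_multigraph_def pairs_iff subsetD)
        then have "e = {x, y}" using x(2) \<open>y \<in> e\<close> False by (auto simp: card_2_iff)
        then have "(x, y) \<in> adjacency n g" using adjacency_multigraph[OF g] x(1) by simp
        then show ?thesis using x(3) by (auto simp: R_def intro: rtrancl_into_rtrancl)
      qed (use x in simp)
    qed
    have "A \<union> (keys g - A) = keys g" by (auto simp: A_def)
    moreover have "\<Union>A \<inter> \<Union>(keys g - A) = {}" using reach by (auto simp: A_def)
    ultimately have "A = {} \<or> keys g - A = {}" using ind unfolding indecomposable_def by blast
    moreover have "{i, u} \<in> A" using uw by (auto simp: A_def R_def)
    ultimately have "{k, w} \<in> A" using uw by blast
    then have "(i, k) \<in> R" using reach by blast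
    moreover from this have "(k, i) \<in> R" using \<open>sym R\<close> by (simp add: symD)
    ultimately show ?thesis
      unfolding comp_def R_def by (auto intro: rtrancl_trans)
  qed
  have "C = D" if "C \<in> {C \<in> connected_components n g. \<not> is_singleton C}"
      "D \<in> {C \<in> connected_components n g. \<not> is_singleton C}" for C D
  proof -
    from that obtain i k where "i \<in> {1..n}" "C = comp i" "k \<in> {1..n}" "D = comp k"
      by (auto simp: connected_components_eq comp_def R_def)
    with that eq show ?thesis by auto
  qed
  moreover have "finite {C \<in> connected_components n g. \<not> is_singleton C}"
    by (simp add: connected_components_eq)
  ultimately show ?thesis
    unfolding quasi_connected_def by (simp add: card_le_Suc0_iff_eq)
qed

lemma quasi_connected_iff_indecomposable:
  "is_multigraph n g \<Longrightarrow> quasi_connected n g \<longleftrightarrow> indecomposable (keys g)"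
  using quasi_connected_imp_indecomposable indecomposable_imp_quasi_connected by blast

section \<open>Splitting an edge set into indecomposable components\<close>

lemma indecomposableD:
  "indecomposable E \<Longrightarrow> A \<union> B = E \<Longrightarrow> \<Union>A \<inter> \<Union>B = {} \<Longrightarrow> A = {} \<or> B = {}"
  by (simp add: indecomposable_def)

text \<open>A splitting of the image pulls back to a splitting of \<open>E\<close>: a common vertex
  of the preimages would map to a common vertex of the images.\<close>

lemma indecomposable_image:
  assumes "indecomposable E"
  shows "indecomposable (image \<sigma> ` E)"
  unfolding indecomposable_def
proof (intro allI impI)
  fix A B assume AB: "A \<union> B = image \<sigma> ` E" "\<Union>A \<inter> \<Union>B = {}"
  define A' B' where "A' = {e \<in> E. \<sigma> ` e \<in> A}" and "B' = {e \<in> E. \<sigma> ` e \<in> B}"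
  have "A' \<union> B' = E" using AB(1) by (auto simp: A'_def B'_def)
  moreover have "\<Union>A' \<inter> \<Union>B' = {}" using AB(2) unfolding A'_def B'_def by blast
  ultimately have "A' = {} \<or> B' = {}" by (rule indecomposableD[OF assms])
  moreover have "A \<subseteq> image \<sigma> ` E" "B \<subseteq> image \<sigma> ` E"
    by (simp_all flip: AB(1))
  then have "A \<subseteq> image \<sigma> ` A'" "B \<subseteq> image \<sigma> ` B'"
    by (auto simp: A'_def B'_def)
  ultimately show "A = {} \<or> B = {}" by blast
qed

text \<open>The non-trivial connected components, each given by its set of edges instead of its
  vertices; isolated vertices leave no trace.\<close>

definition edge_components :: "'a set set \<Rightarrow> 'a set set set" where
  "edge_components E = {K. K \<noteq> {} \<and> K \<subseteq> E \<and> indecomposable K \<and> \<Union>K \<inter> \<Union>(E - K) = {}}"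

lemma finite_edge_components: "finite E \<Longrightarrow> finite (edge_components E)"
  by (rule finite_subset[of _ "Pow E"]) (auto simp: edge_components_def)

lemma edge_components_empty [simp]: "edge_components {} = {}"
  by (auto simp: edge_components_def)

text \<open>Any component \<open>K\<close> splits \<open>E\<close> into \<open>K\<close> and
  \<open>E - K\<close>.\<close>

lemma edge_components_indecomposable:
  assumes "indecomposable E" "{} \<notin> E" "E \<noteq> {}"
  shows "edge_components E = {E}"
proof -
  have "K = E" if K: "K \<in> edge_components E" for K
  proof -
    have "K \<union> (E - K) = E" "\<Union>K \<inter> \<Union>(E - K) = {}" "K \<noteq> {}"
      using K by (auto simp: edge_components_def)
    then show ?thesis using indecomposableD[OF assms(1)] by blast
  qed
  then show ?thesis using assms by (auto simp: edge_components_def)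
qed

text \<open>An indecomposable set cannot have edges in both of two vertex-disjoint parts, and
  separation from the rest of its own part gives separation from the rest of the union.\<close>

lemma edge_components_Un:
  assumes disj: "\<Union>E \<inter> \<Union>F = {}" and ne: "{} \<notin> E" "{} \<notin> F"
  shows "edge_components (E \<union> F) = edge_components E \<union> edge_components F"
proof (intro equalityI subsetI)
  fix K assume K: "K \<in> edge_components (E \<union> F)"
  have "(K \<inter> E) \<union> (K \<inter> F) = K" "\<Union>(K \<inter> E) \<inter> \<Union>(K \<inter> F) = {}"
    using K disj by (auto simp: edge_components_def)
  then have "K \<inter> E = {} \<or> K \<inter> F = {}"
    using K indecomposableD by (metis (no_types, lifting) edge_components_def mem_Collect_eq)
  then have "K \<subseteq> F \<or> K \<subseteq> E" using K by (auto simp: edge_components_def)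
  then show "K \<in> edge_components E \<union> edge_components F"
    using K by (auto simp: edge_components_def)
next
  fix K assume K: "K \<in> edge_components E \<union> edge_components F"
  have "E \<union> F - K \<subseteq> (E - K) \<union> F" "E \<union> F - K \<subseteq> (F - K) \<union> E" by auto
  then have "\<Union>(E \<union> F - K) \<subseteq> \<Union>(E - K) \<union> \<Union>F" "\<Union>(E \<union> F - K) \<subseteq> \<Union>(F - K) \<union> \<Union>E"
    by blast+
  moreover have "K \<subseteq> E \<and> \<Union>K \<inter> \<Union>(E - K) = {} \<or> K \<subseteq> F \<and> \<Union>K \<inter> \<Union>(F - K) = {}"
    using K by (auto simp: edge_components_def)
  ultimately have "\<Union>K \<inter> \<Union>(E \<union> F - K) = {}"
    using disj by blast
  then show "K \<in> edge_components (E \<union> F)"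
    using K by (auto simp: edge_components_def)
qed

text \<open>If \<open>K\<close> and \<open>L\<close> shared an edge, then
  \<open>K \<inter> L\<close> and \<open>K - L\<close> would split \<open>K\<close>, and
  symmetrically for \<open>L\<close>, forcing \<open>K = L\<close>.\<close>

lemma edge_components_disjoint:
  assumes "K \<in> edge_components E" "L \<in> edge_components E" "K \<noteq> L"
  shows "\<Union>K \<inter> \<Union>L = {}"
proof -
  have "K \<inter> L = {}"
  proof (rule ccontr)
    assume KL: "K \<inter> L \<noteq> {}"
    have "(K \<inter> L) \<union> (K - L) = K" "\<Union>(K \<inter> L) \<inter> \<Union>(K - L) = {}"
      "(L \<inter> K) \<union> (L - K) = L" "\<Union>(L \<inter> K) \<inter> \<Union>(L - K) = {}"
      using assms unfolding edge_components_def by blast+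
    then have "K - L = {}" "L - K = {}"
      using KL assms indecomposableD unfolding edge_components_def
      by (metis (no_types, lifting) Int_commute mem_Collect_eq)+
    then show False using assms by blast
  qed
  then show ?thesis using assms unfolding edge_components_def by blast
qed

text \<open>The component of an edge \<open>e\<close> is found as a smallest set of edges that
  contains \<open>e\<close> and is separated from the rest of \<open>E\<close>.\<close>

lemma Union_edge_components:
  assumes "finite E" "{} \<notin> E"
  shows "\<Union>(edge_components E) = E"
proof (intro equalityI subsetI)
  fix e assume e: "e \<in> E"
  define closed where "closed K \<longleftrightarrow> e \<in> K \<and> K \<subseteq> E \<and> \<Union>K \<inter> \<Union>(E - K) = {}" for K
  have "closed E" using e by (auto simp: closed_def)
  then obtain K where K: "closed K" and min: "\<And>L. closed L \<Longrightarrow> card K \<le> card L"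
    using ex_has_least_nat[of closed E card] by blast
  have "finite K" using K assms(1) by (auto simp: closed_def intro: finite_subset)
  \<comment> \<open>The part containing \<open>e\<close> is itself separated from the rest, so by
    minimality it is all of \<open>K\<close>; the other part then has no vertices, and so no
    edges.\<close>
  have part: "B = {}" if AB: "A \<union> B = K" "\<Union>A \<inter> \<Union>B = {}" "e \<in> A" for A B
  proof -
    have "\<Union>A \<inter> \<Union>(E - K) = {}" "A \<subseteq> E" using K AB(1) by (auto simp: closed_def)
    moreover have "\<Union>(E - A) \<subseteq> \<Union>B \<union> \<Union>(E - K)" using AB(1) by blast
    ultimately have "closed A" using AB(2,3) unfolding closed_def by blast
    then have "A = K"
      using min[of A] AB(1) \<open>finite K\<close> by (intro card_seteq) auto
    with AB have "B \<subseteq> A" "\<Union>A \<inter> \<Union>B = {}" by auto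
    then have "\<Union>B = {}" by blast
    moreover have "{} \<notin> B" using AB(1) assms(2) K by (auto simp: closed_def)
    ultimately show "B = {}" by (metis Union_empty_conv all_not_in_conv)
  qed
  have "indecomposable K"
    unfolding indecomposable_def
  proof (intro allI impI)
    fix A B assume AB: "A \<union> B = K" "\<Union>A \<inter> \<Union>B = {}"
    have "e \<in> A \<or> e \<in> B" using K AB(1) by (auto simp: closed_def)
    then show "A = {} \<or> B = {}"
      using part[of A B] part[of B A] AB by (auto simp: Un_commute Int_commute)
  qed
  then have "K \<in> edge_components E" using K by (auto simp: closed_def edge_components_def)
  then show "e \<in> \<Union>(edge_components E)" using K by (auto simp: closed_def)
qed (auto simp: edge_components_def)

section \<open>Components of multigraphs and vertex-disjoint families\<close>

definition restrict_edges :: "nat set set \<Rightarrow> multigraph \<Rightarrow> multigraph" where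
  "restrict_edges K g = (\<Sum>e\<in>keys g \<inter> K. single e (lookup g e))"

lemma lookup_restrict_edges: "lookup (restrict_edges K g) e = (if e \<in> K then lookup g e else 0)"
  by (auto simp: restrict_edges_def lookup_sum lookup_single when_def in_keys_iff sum.delta)

lemma keys_restrict_edges: "keys (restrict_edges K g) = keys g \<inter> K"
  by (auto simp: in_keys_iff lookup_restrict_edges split: if_splits)

lemma restrict_edges_keys: "keys g \<subseteq> K \<Longrightarrow> restrict_edges K g = g"
  by (rule poly_mapping_eqI) (auto simp: lookup_restrict_edges in_keys_iff)

lemma restrict_edges_plus:
  "K \<inter> keys h = {} \<Longrightarrow> restrict_edges K (g + h) = restrict_edges K g"
  by (rule poly_mapping_eqI) (auto simp: lookup_restrict_edges lookup_add in_keys_iff)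

definition components :: "multigraph \<Rightarrow> nat set set set" where
  "components g = edge_components (keys g)"

lemma finite_components [simp]: "finite (components g)"
  by (simp add: components_def finite_edge_components)

lemma keys_restrict_component: "K \<in> components g \<Longrightarrow> keys (restrict_edges K g) = K"
  by (auto simp: components_def edge_components_def keys_restrict_edges)

lemma is_multigraph_restrict: "is_multigraph n g \<Longrightarrow> is_multigraph n (restrict_edges K g)"
  by (auto simp: is_multigraph_def keys_restrict_edges)

lemma indecomposable_component:
  "K \<in> components g \<Longrightarrow> indecomposable (keys (restrict_edges K g))"
  using keys_restrict_component[of K g] by (simp add: components_def edge_components_def)

lemma sum_components:
  assumes "{} \<notin> keys g"
  shows "(\<Sum>K\<in>components g. restrict_edges K g) = g"
proof (rule poly_mapping_eqI)
  fix e
  show "lookup (\<Sum>K\<in>components g. restrict_edges K g) e = lookup g e"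
  proof (cases "e \<in> keys g")
    case False
    then show ?thesis by (simp add: lookup_sum lookup_restrict_edges in_keys_iff)
  next
    case True
    then obtain K where K: "K \<in> components g" "e \<in> K"
      using Union_edge_components[of "keys g"] assms by (auto simp: components_def)
    \<comment> \<open>Components are known to be disjoint as vertex sets; a vertex of
      \<open>e\<close> makes this a statement about edges.\<close>
    obtain v where "v \<in> e" using True assms by (metis all_not_in_conv)
    then have "e \<notin> L" if "L \<in> components g" "L \<noteq> K" for L
      using edge_components_disjoint[of L "keys g" K] that K unfolding components_def by blast
    then have "(\<Sum>L\<in>components g. lookup (restrict_edges L g) e) = (\<Sum>L\<in>components g. if L = K then lookup g e else 0)"
      using K by (intro sum.cong) (auto simp: lookup_restrict_edges)
    then show ?thesis using K by (simp add: lookup_sum)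
  qed
qed

definition disjoint_graphs :: "('i \<Rightarrow> multigraph) \<Rightarrow> 'i set \<Rightarrow> bool" where
  "disjoint_graphs f I \<longleftrightarrow> disjoint_family_on (\<lambda>i. verts (f i)) I"

lemma disjoint_graphs_insert:
  "i \<notin> I \<Longrightarrow> finite I \<Longrightarrow> disjoint_graphs f (insert i I) \<longleftrightarrow>
     disjoint_graphs f I \<and> verts (f i) \<inter> verts (\<Sum>j\<in>I. f j) = {}"
  by (auto simp: disjoint_graphs_def disjoint_family_on_insert verts_sum)

lemma disjoint_graphs_components: "disjoint_graphs (\<lambda>K. restrict_edges K g) (components g)"
  unfolding disjoint_graphs_def disjoint_family_on_def
proof (intro ballI impI)
  fix K L assume "K \<in> components g" "L \<in> components g" "K \<noteq> L"
  then show "verts (restrict_edges K g) \<inter> verts (restrict_edges L g) = {}"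
    using edge_components_disjoint[of K "keys g" L]
    by (simp add: verts_def keys_restrict_component) (simp add: components_def)
qed

text \<open>The equality case is the source of triangularity. Both claims are proved in one
  induction, because equality for \<open>insert i I\<close> forces equality for \<open>I\<close>
  only in view of the inequality for \<open>I\<close>.\<close>

lemma card_verts_sum:
  assumes "finite I" "\<And>i. i \<in> I \<Longrightarrow> is_multigraph n (f i)"
  shows "card (verts (\<Sum>i\<in>I. f i)) \<le> (\<Sum>i\<in>I. card (verts (f i)))"
    and "card (verts (\<Sum>i\<in>I. f i)) = (\<Sum>i\<in>I. card (verts (f i))) \<longleftrightarrow> disjoint_graphs f I"
proof -
  have "card (verts (\<Sum>i\<in>I. f i)) \<le> (\<Sum>i\<in>I. card (verts (f i))) \<and>
     (card (verts (\<Sum>i\<in>I. f i)) = (\<Sum>i\<in>I. card (verts (f i))) \<longleftrightarrow> disjoint_graphs f I)"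
    using assms
  proof (induction I rule: finite_induct)
    case empty
    then show ?case by (simp add: disjoint_graphs_def disjoint_family_on_def)
  next
    case (insert i I)
    let ?s = "\<Sum>j\<in>I. f j"
    have fin: "finite (verts (f i))" "finite (verts ?s)"
      using insert by (auto intro!: finite_verts[of n] simp: is_multigraph_sum)
    have "card (verts (f i)) + card (verts ?s) =
        card (verts (f i + ?s)) + card (verts (f i) \<inter> verts ?s)"
      unfolding verts_plus using fin by (rule card_Un_Int)
    moreover have "card (verts (f i) \<inter> verts ?s) = 0 \<longleftrightarrow> verts (f i) \<inter> verts ?s = {}"
      using fin by simp
    moreover have "card (verts ?s) \<le> (\<Sum>i\<in>I. card (verts (f i)))"
      "card (verts ?s) = (\<Sum>i\<in>I. card (verts (f i))) \<longleftrightarrow> disjoint_graphs f I"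
      using insert.IH insert.prems by simp_all
    moreover note disjoint_graphs_insert[OF insert.hyps(2,1), of f]
    ultimately show ?case
      unfolding sum.insert[OF insert.hyps(1,2)] by auto
  qed
  then show "card (verts (\<Sum>i\<in>I. f i)) \<le> (\<Sum>i\<in>I. card (verts (f i)))"
    and "card (verts (\<Sum>i\<in>I. f i)) = (\<Sum>i\<in>I. card (verts (f i))) \<longleftrightarrow> disjoint_graphs f I"
    by auto
qed

section \<open>Products of orbit sums of connected components\<close>

text \<open>The \<open>P g\<close> of the overview. For the edgeless graph the product is empty and
  equals 1.\<close>

definition component_product :: "nat \<Rightarrow> multigraph \<Rightarrow> 'k::field edge_poly" where
  "component_product n g = (\<Prod>K\<in>components g. orbit_sum n (restrict_edges K g))"

text \<open>The components of vertex-disjoint graphs are collected without interaction, and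
  restricting to a component of one graph ignores the other.\<close>

lemma component_product_plus:
  assumes ne: "{} \<notin> keys g" "{} \<notin> keys h" and disj: "verts g \<inter> verts h = {}"
  shows "component_product n (g + h) =
    (component_product n g * component_product n h :: 'k::field edge_poly)"
proof -
  have kd: "keys g \<inter> keys h = {}"
  proof (rule ccontr)
    assume "keys g \<inter> keys h \<noteq> {}"
    then obtain e where "e \<in> keys g" "e \<in> keys h" by blast
    moreover from this obtain v where "v \<in> e" using ne by (metis all_not_in_conv)
    ultimately show False using disj unfolding verts_def by blast
  qed
  have sub: "K \<subseteq> keys f \<and> K \<noteq> {}" if "K \<in> components f" for K f
    using that by (auto simp: components_def edge_components_def)
  have "components (g + h) = components g \<union> components h"
    using ne disj by (simp add: components_def keys_plus_nat edge_components_Un verts_def)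
  moreover have "components g \<inter> components h = {}" using sub kd by blast
  ultimately have "component_product n (g + h) =
      (\<Prod>K\<in>components g. orbit_sum n (restrict_edges K (g + h))) *
      (\<Prod>K\<in>components h. orbit_sum n (restrict_edges K (h + g)))"
    by (simp add: component_product_def prod.union_disjoint add.commute)
  also have "(\<Prod>K\<in>components g. orbit_sum n (restrict_edges K (g + h))) =
      (component_product n g :: 'k edge_poly)"
  proof -
    have "restrict_edges K (g + h) = restrict_edges K g" if "K \<in> components g" for K
      using sub[OF that] kd by (intro restrict_edges_plus) blast
    then show ?thesis by (simp add: component_product_def)
  qed
  also have "(\<Prod>K\<in>components h. orbit_sum n (restrict_edges K (h + g))) =
      (component_product n h :: 'k edge_poly)"
  proof -
    have "restrict_edges K (h + g) = restrict_edges K h" if "K \<in> components h" for K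
      using sub[OF that] kd by (intro restrict_edges_plus) blast
    then show ?thesis by (simp add: component_product_def)
  qed
  finally show ?thesis .
qed

lemma component_product_indecomposable:
  assumes "{} \<notin> keys g" "indecomposable (keys g)"
  shows "component_product n g = orbit_sum n g"
proof (cases "g = 0")
  case True
  then show ?thesis by (simp add: component_product_def components_def)
next
  case False
  then have "keys g \<noteq> {}"
    by (metis in_keys_iff ex_in_conv lookup_zero poly_mapping_eqI)
  then have "components g = {keys g}"
    using assms by (simp add: components_def edge_components_indecomposable)
  then show ?thesis by (simp add: component_product_def restrict_edges_keys)
qed

text \<open>The \<open>f i\<close> are the components of their sum, except that an edgeless
  \<open>f i\<close> yields no component on the left and a factor 1 on the right.\<close>

lemma component_product_sum:
  assumes "finite I" "disjoint_graphs f I"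
    and "\<And>i. i \<in> I \<Longrightarrow> is_multigraph n (f i)" "\<And>i. i \<in> I \<Longrightarrow> indecomposable (keys (f i))"
  shows "component_product n (\<Sum>i\<in>I. f i) = (\<Prod>i\<in>I. orbit_sum n (f i) :: 'k::field edge_poly)"
  using assms
proof (induction I rule: finite_induct)
  case empty
  then show ?case by (simp add: component_product_def components_def)
next
  case (insert i I)
  have disj: "disjoint_graphs f I" "verts (f i) \<inter> verts (\<Sum>j\<in>I. f j) = {}"
    using insert by (simp_all add: disjoint_graphs_insert)
  have "is_multigraph n (f i)" "is_multigraph n (\<Sum>j\<in>I. f j)"
    using insert by (simp_all add: is_multigraph_sum)
  then have "component_product n (f i + (\<Sum>j\<in>I. f j)) =
      component_product n (f i) * (component_product n (\<Sum>j\<in>I. f j) :: 'k edge_poly)"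
    using disj by (intro component_product_plus empty_not_edge)
  moreover have "component_product n (f i) = (orbit_sum n (f i) :: 'k edge_poly)"
    using insert.prems \<open>is_multigraph n (f i)\<close>
    by (intro component_product_indecomposable empty_not_edge) auto
  ultimately show ?case using insert disj by simp
qed

text \<open>The graphs are placed one after another: those already placed occupy at most the sum of
  their vertex numbers, which leaves enough free vertices for the next one.\<close>

lemma exists_disjoint_orbit_representatives:
  assumes "finite I" "\<And>i. i \<in> I \<Longrightarrow> is_multigraph n (f i)"
    and "(\<Sum>i\<in>I. card (verts (f i))) \<le> n"
  shows "\<exists>t. (\<forall>i\<in>I. t i \<in> graph_orbit n (f i)) \<and> disjoint_graphs t I"
  using assms
proof (induction I rule: finite_induct)
  case empty
  then show ?case by (simp add: disjoint_graphs_def disjoint_family_on_def)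
next
  case (insert i I)
  then obtain t where t: "\<And>j. j \<in> I \<Longrightarrow> t j \<in> graph_orbit n (f j)" "disjoint_graphs t I"
    by auto
  have fi: "is_multigraph n (f i)" using insert.prems by simp
  have tm: "is_multigraph n (t j)" if "j \<in> I" for j
    using t(1)[OF that] insert.prems(1) that is_multigraph_graph_orbit by blast
  define W where "W = verts (\<Sum>j\<in>I. t j)"
  have W: "W \<subseteq> {1..n}"
    unfolding W_def using tm insert.hyps by (intro verts_subset) (simp add: is_multigraph_sum)
  have "card W \<le> (\<Sum>j\<in>I. card (verts (t j)))"
    unfolding W_def using card_verts_sum(1)[OF insert.hyps(1) tm] by simp
  also have "\<dots> = (\<Sum>j\<in>I. card (verts (f j)))"
    using t(1) by (intro sum.cong) (auto intro: card_verts_graph_orbit)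
  finally have "card (verts (f i)) \<le> card ({1..n} - W)"
    using insert.prems(2) insert.hyps W by (simp add: card_Diff_subset finite_subset)
  \<comment> \<open>\<open>\<phi>\<close> moves the new graph to free vertices; it is then extended
    to a permutation of all vertices.\<close>
  then obtain \<phi> where \<phi>: "\<phi> ` verts (f i) \<subseteq> {1..n} - W" "inj_on \<phi> (verts (f i))"
    using card_le_inj[of "verts (f i)" "{1..n} - W"] finite_verts[OF fi] by auto
  then obtain \<sigma> where \<sigma>: "\<sigma> permutes {1..n}" "\<And>x. x \<in> verts (f i) \<Longrightarrow> \<sigma> x = \<phi> x"
    using exists_permutes_extending[of "{1..n}" "verts (f i)" \<phi>] verts_subset[OF fi] by blast
  define t' where "t' = t(i := relabel \<sigma> (f i))"
  have eq: "(\<Sum>j\<in>I. t' j) = (\<Sum>j\<in>I. t j)"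
    using insert.hyps by (intro sum.cong) (auto simp: t'_def)
  have "verts (t' i) = \<phi> ` verts (f i)"
    using \<sigma> by (simp add: t'_def verts_relabel permutes_bij)
  then have "verts (t' i) \<inter> verts (\<Sum>j\<in>I. t' j) = {}" using \<phi>(1) eq W_def by auto
  moreover have "disjoint_graphs t' I"
    using t(2) insert.hyps by (auto simp: disjoint_graphs_def disjoint_family_on_def t'_def)
  ultimately have "disjoint_graphs t' (insert i I)"
    using insert.hyps by (simp add: disjoint_graphs_insert)
  moreover have "\<forall>j\<in>insert i I. t' j \<in> graph_orbit n (f j)"
    using t(1) insert.hyps \<sigma>(1) by (auto simp: t'_def intro: relabel_in_graph_orbit graph_orbit_self)
  ultimately show ?case by blast
qed

text \<open>The permutations carrying \<open>g\<close> to \<open>g'\<close> and \<open>h\<close> to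
  \<open>h'\<close> may differ. Disjointness of \<open>g\<close> and \<open>h\<close> lets them be
  glued along the vertex sets, disjointness of the images makes the result injective, and it extends
  to one permutation.\<close>

lemma graph_orbit_plus:
  assumes g: "is_multigraph n g" "is_multigraph n h"
    and orb: "g' \<in> graph_orbit n g" "h' \<in> graph_orbit n h"
    and disj: "verts g \<inter> verts h = {}" "verts g' \<inter> verts h' = {}"
  shows "g' + h' \<in> graph_orbit n (g + h)"
proof -
  obtain \<sigma> \<tau> where \<sigma>: "\<sigma> permutes {1..n}" "g' = relabel \<sigma> g" and \<tau>: "\<tau> permutes {1..n}" "h' = relabel \<tau> h"
    using orb by (auto simp: graph_orbit_def)
  define \<phi> where "\<phi> x = (if x \<in> verts g then \<sigma> x else \<tau> x)" for x
  have img: "\<phi> ` verts g = verts g'" "\<phi> ` verts h = verts h'"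
    using \<sigma> \<tau> disj(1) by (auto simp: verts_relabel permutes_bij \<phi>_def)
  have \<phi>_eq: "\<phi> x = \<sigma> x" if "x \<in> verts g" for x using that by (simp add: \<phi>_def)
  have \<phi>_eq': "\<phi> x = \<tau> x" if "x \<in> verts h" for x using that disj(1) by (auto simp: \<phi>_def)
  have "inj_on \<phi> (verts g)" "inj_on \<phi> (verts h)"
    using inj_on_subset[OF permutes_inj[OF \<sigma>(1)], of "verts g"]
      inj_on_subset[OF permutes_inj[OF \<tau>(1)], of "verts h"]
    by (simp_all add: inj_on_def \<phi>_eq \<phi>_eq')
  then have inj: "inj_on \<phi> (verts g \<union> verts h)"
    using disj(2) img by (subst inj_on_Un) blast
  have "\<phi> ` (verts g \<union> verts h) \<subseteq> {1..n}"
    using img verts_subset is_multigraph_graph_orbit orb g by (simp add: image_Un)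
  then obtain \<rho> where \<rho>: "\<rho> permutes {1..n}" "\<And>x. x \<in> verts g \<union> verts h \<Longrightarrow> \<rho> x = \<phi> x"
    using exists_permutes_extending[of "{1..n}" "verts g \<union> verts h" \<phi>] inj verts_subset g
    by (metis Un_subset_iff finite_atLeastAtMost)
  have "relabel \<rho> g = g'" "relabel \<rho> h = h'"
    unfolding \<sigma>(2) \<tau>(2) by (rule relabel_cong; simp add: \<rho>(2) \<phi>_eq \<phi>_eq')+
  then have "g' + h' = relabel \<rho> (g + h)" by (simp add: relabel_add)
  then show ?thesis using \<rho>(1) by (auto simp: graph_orbit_def)
qed

lemma graph_orbit_sum:
  assumes "finite I" "\<And>i. i \<in> I \<Longrightarrow> is_multigraph n (f i)" "\<And>i. i \<in> I \<Longrightarrow> t i \<in> graph_orbit n (f i)"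
    and "disjoint_graphs f I" "disjoint_graphs t I"
  shows "(\<Sum>i\<in>I. t i) \<in> graph_orbit n (\<Sum>i\<in>I. f i)"
  using assms
proof (induction I rule: finite_induct)
  case empty
  then show ?case by (simp add: graph_orbit_self)
next
  case (insert i I)
  then show ?case
    by (simp add: disjoint_graphs_insert, intro graph_orbit_plus) (auto simp: is_multigraph_sum)
qed

section \<open>Supports and coefficients of products of orbit sums\<close>

lemma lookup_monomial_mult: "lookup (single h 1 * q :: 'k::field edge_poly) (h + m) = lookup q m"
  by (induction q rule: edge_poly_induct)
    (simp_all add: distrib_left mult_single lookup_add lookup_single when_def)

lemma lookup_monomial_mult_Nats:
  fixes q :: "'k::field edge_poly"
  assumes "\<And>m. lookup q m \<in> \<nat>"
  shows "lookup (single h 1 * q) k \<in> \<nat>"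
proof (cases "\<exists>m. k = h + m")
  case True
  then show ?thesis using assms lookup_monomial_mult by metis
next
  case False
  then have "k \<notin> keys (single h 1 * q)" using keys_mult[of "single h 1" q] by auto
  then show ?thesis by (simp add: in_keys_iff)
qed

lemma sum_Nats:
  assumes "\<And>i. i \<in> I \<Longrightarrow> f i \<in> (\<nat> :: 'k::semiring_1 set)"
  shows "(\<Sum>i\<in>I. f i) \<in> \<nat>"
  using assms by (induction I rule: infinite_finite_induct) auto

text \<open>Characteristic zero enters here: natural number coefficients cannot cancel.\<close>

lemma add_Nats_nonzero:
  fixes a b :: "'k::semiring_char_0"
  assumes "a \<in> \<nat>" "b \<in> \<nat>" "a \<noteq> 0"
  shows "a + b \<noteq> 0"
  using assms by (auto elim!: Nats_cases simp flip: of_nat_add)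

text \<open>The summand of \<open>h\<close> contributes the non-zero coefficient of \<open>q\<close>
  at \<open>m\<close>, and the other summands only add natural numbers.\<close>

lemma orbit_sum_mult_Nats:
  fixes q :: "'k::field_char_0 edge_poly"
  assumes "\<And>m. lookup q m \<in> \<nat>"
  shows "lookup (orbit_sum n g * q) k \<in> \<nat>"
    and "h \<in> graph_orbit n g \<Longrightarrow> m \<in> keys q \<Longrightarrow> h + m \<in> keys (orbit_sum n g * q)"
proof -
  have eq: "lookup (orbit_sum n g * q) k = (\<Sum>h\<in>graph_orbit n g. lookup (single h 1 * q) k)" for k
    by (simp add: orbit_sum_def sum_distrib_right lookup_sum)
  then show "lookup (orbit_sum n g * q) k \<in> \<nat>"
    using lookup_monomial_mult_Nats[OF assms] by (simp add: sum_Nats)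
  assume h: "h \<in> graph_orbit n g" and m: "m \<in> keys q"
  have "lookup (orbit_sum n g * q) (h + m) = lookup (single h 1 * q) (h + m) +
      (\<Sum>h'\<in>graph_orbit n g - {h}. lookup (single h' 1 * q) (h + m))"
    unfolding eq using h by (simp add: sum.remove)
  also have "\<dots> \<noteq> 0"
    using m assms[of m] lookup_monomial_mult_Nats[OF assms]
    by (intro add_Nats_nonzero sum_Nats) (auto simp: lookup_monomial_mult in_keys_iff)
  finally show "h + m \<in> keys (orbit_sum n g * q)" by (simp add: in_keys_iff)
qed

lemma prod_orbit_sums_Nats:
  "finite I \<Longrightarrow> lookup (\<Prod>i\<in>I. orbit_sum n (f i) :: 'k::field_char_0 edge_poly) m \<in> \<nat>"
  by (induction I arbitrary: m rule: finite_induct)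
    (auto simp: lookup_one when_def intro: orbit_sum_mult_Nats(1))

lemma prod_orbit_sums_keysI:
  assumes "finite I" "\<And>i. i \<in> I \<Longrightarrow> t i \<in> graph_orbit n (f i)"
  shows "(\<Sum>i\<in>I. t i) \<in> keys (\<Prod>i\<in>I. orbit_sum n (f i) :: 'k::field_char_0 edge_poly)"
  using assms
  by (induction I rule: finite_induct) (simp_all add: orbit_sum_mult_Nats(2) prod_orbit_sums_Nats)

lemma prod_orbit_sums_keysE:
  assumes "finite I" "m \<in> keys (\<Prod>i\<in>I. orbit_sum n (f i) :: 'k::field edge_poly)"
  obtains t where "\<And>i. i \<in> I \<Longrightarrow> t i \<in> graph_orbit n (f i)" "m = (\<Sum>i\<in>I. t i)"
proof -
  have "\<exists>t. (\<forall>i\<in>I. t i \<in> graph_orbit n (f i)) \<and> m = (\<Sum>i\<in>I. t i)"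
    using assms
  proof (induction I arbitrary: m rule: finite_induct)
    case (insert i I)
    then obtain h m' where hm: "h \<in> graph_orbit n (f i)" "m = h + m'"
        "m' \<in> keys (\<Prod>i\<in>I. orbit_sum n (f i) :: 'k edge_poly)"
      using keys_mult[of "orbit_sum n (f i) :: 'k edge_poly" "\<Prod>i\<in>I. orbit_sum n (f i)"]
      by (auto simp: keys_orbit_sum)
    then obtain t where "\<forall>i\<in>I. t i \<in> graph_orbit n (f i)" "m' = (\<Sum>i\<in>I. t i)"
      using insert.IH by blast
    moreover have "(\<Sum>j\<in>I. (t(i := h)) j) = (\<Sum>j\<in>I. t j)"
      using insert.hyps by (intro sum.cong) auto
    ultimately show ?case
      using hm insert.hyps by (intro exI[of _ "t(i := h)"]) auto
  qed simp
  then show ?thesis using that by blast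
qed

text \<open>The diagonal entry of the triangular system: every component is chosen as the
  representative of its own orbit.\<close>

lemma component_product_lookup_self:
  assumes "is_multigraph n g"
  shows "g \<in> keys (component_product n g :: 'k::field_char_0 edge_poly)"
  using prod_orbit_sums_keysI[of "components g" "\<lambda>K. restrict_edges K g" n "\<lambda>K. restrict_edges K g"]
  by (simp add: component_product_def sum_components empty_not_edge[OF assms] graph_orbit_self)

lemma indecomposable_graph_orbit:
  "h \<in> graph_orbit n g \<Longrightarrow> indecomposable (keys g) \<Longrightarrow> indecomposable (keys h)"
  by (auto simp: graph_orbit_def keys_relabel permutes_bij indecomposable_image)

text \<open>Triangularity. A monomial superposes one relabelled copy of each component; counted with
  overlaps, the copies have as many vertices as \<open>g\<close>, so equality means that they are
  disjoint. In that case \<open>m\<close> has the same product as \<open>g\<close>, which is what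
  the independence proof needs.\<close>

lemma keys_component_product:
  assumes g: "is_multigraph n g" and m: "m \<in> keys (component_product n g :: 'k::field edge_poly)"
  shows "is_multigraph n m" "num_edges m = num_edges g" "card (verts m) \<le> card (verts g)"
    and "card (verts m) = card (verts g) \<Longrightarrow> m \<in> graph_orbit n g"
    and "card (verts m) = card (verts g) \<Longrightarrow>
      component_product n m = (component_product n g :: 'k edge_poly)"
proof -
  let ?c = "components g" and ?f = "\<lambda>K. restrict_edges K g"
  obtain t where t: "\<And>K. K \<in> ?c \<Longrightarrow> t K \<in> graph_orbit n (?f K)" "m = (\<Sum>K\<in>?c. t K)"
    using m unfolding component_product_def by (rule prod_orbit_sums_keysE[OF finite_components]) blast
  have gs: "(\<Sum>K\<in>?c. ?f K) = g" by (simp add: sum_components empty_not_edge[OF g])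
  have fm: "is_multigraph n (?f K)" for K using g by (rule is_multigraph_restrict)
  have tm: "is_multigraph n (t K)" if "K \<in> ?c" for K
    using t(1)[OF that] fm is_multigraph_graph_orbit by blast
  show "is_multigraph n m" using tm by (simp add: t(2) is_multigraph_sum)
  have "num_edges m = (\<Sum>K\<in>?c. num_edges (?f K))"
    unfolding t(2) num_edges_sum using t(1) by (intro sum.cong) (auto intro: num_edges_graph_orbit)
  also have "\<dots> = num_edges g" by (simp add: gs flip: num_edges_sum)
  finally show "num_edges m = num_edges g" .
  have "(\<Sum>K\<in>?c. card (verts (t K))) = (\<Sum>K\<in>?c. card (verts (?f K)))"
    using t(1) by (intro sum.cong) (auto intro: card_verts_graph_orbit)
  also have "\<dots> = card (verts g)"
    using disjoint_graphs_components[of g] card_verts_sum(2)[of ?c n ?f] fm by (simp add: gs)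
  finally have sum: "(\<Sum>K\<in>?c. card (verts (t K))) = card (verts g)" .
  show "card (verts m) \<le> card (verts g)"
    using card_verts_sum(1)[of ?c n t] tm by (simp add: t(2) sum)
  assume eq: "card (verts m) = card (verts g)"
  have disj: "disjoint_graphs t ?c"
    using card_verts_sum(2)[of ?c n t] tm eq by (simp add: t(2) sum)
  show "m \<in> graph_orbit n g"
    using graph_orbit_sum[OF finite_components, of g n ?f t] fm t(1) disj disjoint_graphs_components[of g]
    by (simp add: gs t(2))
  \<comment> \<open>The disjoint indecomposable copies \<open>t K\<close> serve as the components of
    \<open>m\<close>, and orbit sums do not distinguish a component from its copy.\<close>
  have "component_product n m = (\<Prod>K\<in>?c. orbit_sum n (t K) :: 'k edge_poly)"
    unfolding t(2) using tm t(1) disj indecomposable_component indecomposable_graph_orbit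
    by (intro component_product_sum finite_components) blast+
  also have "\<dots> = component_product n g"
    unfolding component_product_def using t(1) by (intro prod.cong orbit_sum_eq) auto
  finally show "component_product n m = (component_product n g :: 'k edge_poly)" .
qed

lemma component_product_invariant:
  "is_multigraph n g \<Longrightarrow> component_product n g \<in> (invariants n :: 'k::field edge_poly set)"
  unfolding component_product_def
  by (intro is_subalgebra_prod invariants_is_subalgebra orbit_sum_invariant is_multigraph_restrict)

section \<open>The products as a basis of each homogeneous component\<close>

lemma prod_list_prod_nth:
  "prod_list (map f xs) = (\<Prod>i = 0..<length xs. f (xs ! i) :: 'a::comm_monoid_mult)"
  by (induction xs rule: rev_induct) (auto simp: nth_append)

text \<open>Factors can be moved to disjoint places without changing their orbit sums; conversely,
  the components of a graph together have no more than \<open>n\<close> vertices.\<close>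

lemma orbit_sum_products_eq:
  "orbit_sum_products n d =
    (component_product n ` {g. is_multigraph n g \<and> num_edges g = d} :: 'k::field edge_poly set)"
proof (intro equalityI subsetI)
  fix p :: "'k edge_poly"
  assume "p \<in> orbit_sum_products n d"
  then obtain cs where cs: "p = prod_list (map (orbit_sum n) cs)"
      "\<And>c. c \<in> set cs \<Longrightarrow> is_multigraph n c" "\<And>c. c \<in> set cs \<Longrightarrow> quasi_connected n c"
      "(\<Sum>c\<leftarrow>cs. card (non_isolated_vertices n c)) \<le> n" "(\<Sum>c\<leftarrow>cs. num_edges c) = d"
    by (auto simp: orbit_sum_products_def)
  \<comment> \<open>Factors are indexed by list positions, since the same multigraph may occur
    several times.\<close>
  let ?I = "{0..<length cs}"
  have cm: "is_multigraph n (cs ! i)" and cq: "indecomposable (keys (cs ! i))" if "i \<in> ?I" for i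
    using cs(2,3) that by (auto intro!: quasi_connected_imp_indecomposable[of n])
  have "(\<Sum>i\<in>?I. card (verts (cs ! i))) \<le> n"
    using cs(4) cm by (simp add: sum_list_sum_nth non_isolated_vertices_eq_verts)
  then obtain t where t: "\<And>i. i \<in> ?I \<Longrightarrow> t i \<in> graph_orbit n (cs ! i)" "disjoint_graphs t ?I"
    using exists_disjoint_orbit_representatives[of ?I n "(!) cs"] cm by blast
  have tm: "is_multigraph n (t i)" "indecomposable (keys (t i))" if "i \<in> ?I" for i
    using that t(1) cm cq is_multigraph_graph_orbit indecomposable_graph_orbit by blast+
  have "p = (\<Prod>i\<in>?I. orbit_sum n (cs ! i))"
    by (simp add: cs(1) prod_list_prod_nth)
  also have "\<dots> = (\<Prod>i\<in>?I. orbit_sum n (t i))"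
    using t(1) by (intro prod.cong) (auto intro!: orbit_sum_eq[symmetric])
  also have "\<dots> = component_product n (\<Sum>i\<in>?I. t i)"
    using tm t(2) by (intro component_product_sum[symmetric]) auto
  finally have "p = component_product n (\<Sum>i\<in>?I. t i)" .
  moreover have "is_multigraph n (\<Sum>i\<in>?I. t i)" using tm by (simp add: is_multigraph_sum)
  moreover have "num_edges (\<Sum>i\<in>?I. t i) = d"
  proof -
    have "num_edges (\<Sum>i\<in>?I. t i) = (\<Sum>i\<in>?I. num_edges (cs ! i))"
      unfolding num_edges_sum using t(1) by (intro sum.cong) (auto intro: num_edges_graph_orbit)
    then show ?thesis using cs(5) by (simp add: sum_list_sum_nth)
  qed
  ultimately show "p \<in> component_product n ` {g. is_multigraph n g \<and> num_edges g = d}" by blast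
next
  fix p :: "'k edge_poly"
  assume "p \<in> component_product n ` {g. is_multigraph n g \<and> num_edges g = d}"
  then obtain g where g: "is_multigraph n g" "num_edges g = d" "p = component_product n g" by blast
  let ?f = "\<lambda>K. restrict_edges K g"
  obtain Ks where Ks: "set Ks = components g" "distinct Ks"
    using finite_distinct_list[OF finite_components] by blast
  have gs: "(\<Sum>K\<in>components g. ?f K) = g" by (simp add: sum_components empty_not_edge[OF g(1)])
  have fm: "is_multigraph n (?f K)" for K using g(1) by (rule is_multigraph_restrict)
  define cs where "cs = map ?f Ks"
  have "p = prod_list (map (orbit_sum n) cs)"
    using Ks by (simp add: g(3) cs_def component_product_def prod.distinct_set_conv_list o_def flip: Ks(1))
  moreover have "\<forall>c\<in>set cs. is_multigraph n c \<and> quasi_connected n c"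
    using fm indecomposable_component by (auto simp: cs_def Ks quasi_connected_iff_indecomposable)
  moreover have "(\<Sum>c\<leftarrow>cs. card (non_isolated_vertices n c)) \<le> n"
  proof -
    have "(\<Sum>c\<leftarrow>cs. card (non_isolated_vertices n c)) = (\<Sum>K\<in>components g. card (verts (?f K)))"
      using Ks fm by (simp add: cs_def o_def non_isolated_vertices_eq_verts sum_list_distinct_conv_sum_set)
    also have "\<dots> = card (verts g)"
      using card_verts_sum(2)[of "components g" n ?f] fm disjoint_graphs_components[of g] by (simp add: gs)
    also have "\<dots> \<le> n" using card_mono[OF _ verts_subset[OF g(1)]] by simp
    finally show ?thesis .
  qed
  moreover have "(\<Sum>c\<leftarrow>cs. num_edges c) = d"
  proof -
    have "(\<Sum>c\<leftarrow>cs. num_edges c) = (\<Sum>K\<in>components g. num_edges (?f K))"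
      using Ks by (simp add: cs_def o_def sum_list_distinct_conv_sum_set)
    then show ?thesis by (simp add: gs g(2) flip: num_edges_sum)
  qed
  ultimately show "p \<in> orbit_sum_products n d" unfolding orbit_sum_products_def by blast
qed

text \<open>All graphs of an orbit give the same product, so \<open>\<gamma>\<close> picks one graph
  for each product involved. In a vanishing combination, a graph with the most vertices among the
  non-zero terms gives the contradiction.\<close>

lemma independent_orbit_sum_products:
  "edge_poly.independent (orbit_sum_products n d :: 'k::field_char_0 edge_poly set)"
  unfolding edge_poly.independent_explicit_module
proof (intro allI impI, rule ccontr)
  fix t :: "'k edge_poly set" and u v0
  assume t: "finite t" "t \<subseteq> orbit_sum_products n d" "(\<Sum>v\<in>t. poly_scale (u v) v) = 0"
    and v0: "v0 \<in> t" "u v0 \<noteq> 0"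
  have "\<exists>g. is_multigraph n g \<and> v = component_product n g" if "v \<in> t" for v
    using t(2) that by (auto simp: orbit_sum_products_eq)
  then obtain \<gamma> where \<gamma>: "\<And>v. v \<in> t \<Longrightarrow> is_multigraph n (\<gamma> v)" "\<And>v. v \<in> t \<Longrightarrow> v = component_product n (\<gamma> v)"
    by metis
  define T where "T = {v \<in> t. u v \<noteq> 0}"
  define N where "N v = card (verts (\<gamma> v))" for v
  have T: "finite T" "T \<noteq> {}" using t(1) v0 by (auto simp: T_def)
  then have "Max (N ` T) \<in> N ` T" by (intro Max_in) auto
  then obtain w where "w \<in> T" "N w = Max (N ` T)" by auto
  then have w: "w \<in> T" "\<And>v. v \<in> T \<Longrightarrow> N v \<le> N w" using T by simp_all
  have wt: "w \<in> t" "u w \<noteq> 0" using w(1) by (auto simp: T_def)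
  \<comment> \<open>The exponent \<open>\<gamma> w\<close> occurs in no other product of the combination, since \<open>N w\<close> is maximal.\<close>
  have other: "u v * lookup v (\<gamma> w) = 0" if v: "v \<in> t" "v \<noteq> w" for v
  proof (rule ccontr)
    assume "u v * lookup v (\<gamma> w) \<noteq> 0"
    then have "v \<in> T" "\<gamma> w \<in> keys (component_product n (\<gamma> v) :: 'k edge_poly)"
      using v \<gamma>(2)[of v] by (auto simp: T_def in_keys_iff)
    note k = keys_component_product[OF \<gamma>(1)[OF v(1)] this(2)]
    \<comment> \<open>This is the equality case of triangularity, in which the two products
      coincide.\<close>
    have "N w = N v" using k(3) w(2)[OF \<open>v \<in> T\<close>] by (simp add: N_def)
    then have "component_product n (\<gamma> w) = (component_product n (\<gamma> v) :: 'k edge_poly)"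
      using k(5) by (simp add: N_def)
    then show False using \<gamma>(2)[OF v(1)] \<gamma>(2)[OF wt(1)] v(2) by simp
  qed
  have "0 = lookup (\<Sum>v\<in>t. poly_scale (u v) v) (\<gamma> w)" using t(3) by simp
  also have "\<dots> = (\<Sum>v\<in>t. u v * lookup v (\<gamma> w))" by (simp add: lookup_sum lookup_scale)
  also have "\<dots> = u w * lookup w (\<gamma> w)"
  proof -
    have "(\<Sum>v\<in>t - {w}. u v * lookup v (\<gamma> w)) = 0"
      using other by (intro sum.neutral) auto
    then show ?thesis by (simp add: sum.remove[OF t(1) wt(1)])
  qed
  finally have "lookup w (\<gamma> w) = 0" using wt(2) by simp
  moreover have "\<gamma> w \<in> keys w"
    using component_product_lookup_self[OF \<gamma>(1)[OF wt(1)], where 'k = 'k] \<gamma>(2)[OF wt(1)] by simp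
  ultimately show False by (simp add: in_keys_iff)
qed

text \<open>Inverts the triangular system by induction on the number of vertices: outside the orbit
  of \<open>g\<close>, the product of \<open>g\<close> only contains orbits with fewer
  vertices.\<close>

lemma orbit_sum_in_span_products:
  assumes "is_multigraph n g"
  shows "orbit_sum n g \<in> edge_poly.span (orbit_sum_products n (num_edges g) :: 'k::field_char_0 edge_poly set)"
  using assms
proof (induction "card (verts g)" arbitrary: g rule: less_induct)
  case less
  let ?S = "edge_poly.span (orbit_sum_products n (num_edges g) :: 'k edge_poly set)"
  define P :: "'k edge_poly" where "P = component_product n g"
  \<comment> \<open>By invariance \<open>a\<close> is the coefficient of \<open>P\<close> on the
    whole orbit of \<open>g\<close>, so \<open>q\<close> keeps exactly the monomials outside this
    orbit.\<close>
  define a where "a = lookup P g"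
  define q where "q = P - poly_scale a (orbit_sum n g)"
  have Pinv: "P \<in> invariants n" unfolding P_def by (rule component_product_invariant[OF less.prems])
  have "edge_poly.subspace (invariants n :: 'k edge_poly set)"
    using invariants_is_subalgebra[of n, where 'k = 'k] by (simp add: is_subalgebra_def)
  then have "q \<in> invariants n"
    unfolding q_def using Pinv orbit_sum_invariant[OF less.prems]
    by (intro edge_poly.subspace_diff edge_poly.subspace_scale) auto
  then have "q \<in> edge_poly.span (orbit_sum n ` keys q)" by (rule invariant_in_span_orbit_sums)
  moreover have "orbit_sum n ` keys q \<subseteq> ?S"
  proof
    fix p :: "'k edge_poly" assume "p \<in> orbit_sum n ` keys q"
    then obtain m where m: "m \<in> keys q" "p = orbit_sum n m" by blast
    have q: "lookup q m = (if m \<in> graph_orbit n g then 0 else lookup P m)"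
      using lookup_invariant[OF Pinv, of m g]
      by (simp add: q_def lookup_minus lookup_scale lookup_orbit_sum a_def)
    with m(1) have "m \<notin> graph_orbit n g" "m \<in> keys P"
      by (auto simp: in_keys_iff split: if_splits)
    note k = keys_component_product[OF less.prems this(2)[unfolded P_def]]
    have "card (verts m) \<noteq> card (verts g)" using k(4) \<open>m \<notin> graph_orbit n g\<close> by blast
    then have "card (verts m) < card (verts g)" using k(3) by simp
    then show "p \<in> ?S" using less.hyps[of m] k(1,2) m(2) by simp
  qed
  ultimately have "q \<in> ?S" by (meson edge_poly.span_minimal edge_poly.subspace_span subsetD)
  moreover have "P \<in> ?S"
    unfolding P_def by (rule edge_poly.span_base) (use less.prems in \<open>auto simp: orbit_sum_products_eq\<close>)
  ultimately have "P - q \<in> ?S" by (rule edge_poly.span_diff[rotated])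
  then have "poly_scale (inverse a) (poly_scale a (orbit_sum n g)) \<in> ?S"
    unfolding q_def by (simp only: edge_poly.span_scale diff_diff_eq2 add_diff_cancel_left')
  moreover have "a \<noteq> 0"
    using component_product_lookup_self[OF less.prems, where 'k = 'k] by (simp add: a_def P_def in_keys_iff)
  ultimately show ?case by simp
qed

text \<open>Relabelling and superposition preserve edge numbers, so the products are homogeneous.
  Conversely, all monomials of a homogeneous invariant have degree \<open>d\<close>, so their orbit
  sums are reduced to products of this one degree.\<close>

lemma span_orbit_sum_products:
  "edge_poly.span (orbit_sum_products n d :: 'k::field_char_0 edge_poly set) =
     homogeneous_component d (invariants n)"
proof
  have sub: "edge_poly.subspace (invariants n :: 'k edge_poly set)"
    using invariants_is_subalgebra[of n, where 'k = 'k] by (simp add: is_subalgebra_def)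
  have "edge_poly.subspace (homogeneous_component d (invariants n) :: 'k edge_poly set)"
    unfolding edge_poly.subspace_def homogeneous_component_def
    using edge_poly.subspace_0[OF sub] edge_poly.subspace_add[OF sub] edge_poly.subspace_scale[OF sub]
      keys_add keys_scale_subset by fastforce
  moreover have "orbit_sum_products n d \<subseteq> (homogeneous_component d (invariants n) :: 'k edge_poly set)"
    using component_product_invariant keys_component_product(2)
    by (force simp: orbit_sum_products_eq homogeneous_component_def)
  ultimately show "edge_poly.span (orbit_sum_products n d) \<subseteq>
      (homogeneous_component d (invariants n) :: 'k edge_poly set)"
    by (intro edge_poly.span_minimal)
  show "homogeneous_component d (invariants n) \<subseteq>
      edge_poly.span (orbit_sum_products n d :: 'k edge_poly set)"
  proof
    fix p :: "'k edge_poly" assume p: "p \<in> homogeneous_component d (invariants n)"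
    have "orbit_sum n ` keys p \<subseteq> edge_poly.span (orbit_sum_products n d :: 'k edge_poly set)"
    proof safe
      fix m assume "m \<in> keys p"
      then have "is_multigraph n m" "num_edges m = d"
        using p by (auto simp: homogeneous_component_def invariants_def poly_ring_def)
      then show "orbit_sum n m \<in> edge_poly.span (orbit_sum_products n d :: 'k edge_poly set)"
        using orbit_sum_in_span_products by blast
    qed
    moreover have "p \<in> edge_poly.span (orbit_sum n ` keys p)"
      using p by (intro invariant_in_span_orbit_sums) (simp add: homogeneous_component_def)
    ultimately show "p \<in> edge_poly.span (orbit_sum_products n d)"
      by (meson edge_poly.span_minimal edge_poly.subspace_span subsetD)
  qed
qed

text \<open>No factor has more edges than the whole product.\<close>

lemma orbit_sum_products_in_algebra:
  assumes "d \<le> \<beta>"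
  shows "orbit_sum_products n d \<subseteq> (algebra_generated {orbit_sum n g | g. is_multigraph n g \<and>
      quasi_connected n g \<and> num_edges g \<le> \<beta>} :: 'k::field edge_poly set)"
proof
  let ?A = "algebra_generated {orbit_sum n g | g. is_multigraph n g \<and> quasi_connected n g \<and> num_edges g \<le> \<beta>}
      :: 'k edge_poly set"
  fix p :: "'k edge_poly" assume "p \<in> orbit_sum_products n d"
  then obtain cs where cs: "p = prod_list (map (orbit_sum n) cs)"
      "\<forall>c\<in>set cs. is_multigraph n c \<and> quasi_connected n c" "(\<Sum>c\<leftarrow>cs. num_edges c) = d"
    by (auto simp: orbit_sum_products_def)
  have "num_edges c \<le> \<beta>" if "c \<in> set cs" for c
    using member_le_sum_list[of "num_edges c" "map num_edges cs"] that cs(3) assms by simp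
  then have "orbit_sum n c \<in> ?A" if "c \<in> set cs" for c
    using cs(2) that by (intro subsetD[OF algebra_generated_superset]) auto
  then show "p \<in> ?A"
    unfolding cs(1)
    using is_subalgebra_algebra_generated[of "{orbit_sum n g | g. is_multigraph n g \<and>
      quasi_connected n g \<and> num_edges g \<le> \<beta>}"]
    unfolding is_subalgebra_def by (induction cs) auto
qed

section \<open>Noether's degree bound\<close>

definition perms :: "nat \<Rightarrow> (nat \<Rightarrow> nat) set" where
  "perms n = {\<sigma>. \<sigma> permutes {1..n}}"

text \<open>The transfer, that is, the Reynolds operator without division by the group
  order.\<close>

definition trace_poly :: "nat \<Rightarrow> 'k::field edge_poly \<Rightarrow> 'k edge_poly" where
  "trace_poly n p = (\<Sum>\<sigma>\<in>perms n. perm_act \<sigma> p)"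

lemma finite_perms [simp]: "finite (perms n)"
  by (simp add: perms_def finite_permutations)

lemma card_perms_pos: "card (perms n) > 0"
proof -
  have "id \<in> perms n" by (simp add: perms_def permutes_id)
  then show ?thesis unfolding card_gt_0_iff using finite_perms by blast
qed

lemma trace_poly_add: "trace_poly n (p + q) = trace_poly n p + trace_poly n q"
  by (simp add: trace_poly_def perm_act_add sum.distrib)

lemma trace_poly_scale: "trace_poly n (poly_scale c p) = poly_scale c (trace_poly n p)"
  by (simp add: trace_poly_def perm_act_mult perm_act_const poly_scale_def sum_distrib_left)

lemma trace_poly_invariant: "p \<in> invariants n \<Longrightarrow> trace_poly n p = poly_scale (of_nat (card (perms n))) p"
  by (simp add: trace_poly_def perms_def invariants_def poly_scale_def)

text \<open>Linearity over the invariants, through which the trace will send a module over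
  invariants back to invariants.\<close>

lemma trace_poly_invariant_mult: "p \<in> invariants n \<Longrightarrow> trace_poly n (p * q) = p * trace_poly n q"
  by (simp add: trace_poly_def perms_def invariants_def perm_act_mult sum_distrib_left)

lemma keys_trace_monomial:
  "m' \<in> keys (trace_poly n (single m 1 :: 'k::field edge_poly)) \<Longrightarrow> m' \<in> graph_orbit n m"
  using keys_sum[of "\<lambda>\<sigma>. single (relabel \<sigma> m) (1::'k)" "perms n"]
  by (auto simp: trace_poly_def perm_act_single perms_def graph_orbit_def)

lemma perm_act_trace:
  assumes "\<sigma> permutes {1..n}"
  shows "perm_act \<sigma> (trace_poly n p) = trace_poly n p"
proof -
  have "bij_betw (\<lambda>\<tau>. \<sigma> \<circ> \<tau>) (perms n) (perms n)"
  proof (rule bij_betwI[where g = "\<lambda>\<tau>. inv \<sigma> \<circ> \<tau>"])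
    show "(\<lambda>\<tau>. \<sigma> \<circ> \<tau>) \<in> perms n \<rightarrow> perms n" "(\<lambda>\<tau>. inv \<sigma> \<circ> \<tau>) \<in> perms n \<rightarrow> perms n"
      using assms by (auto simp: perms_def intro: permutes_compose permutes_inv)
    show "inv \<sigma> \<circ> (\<sigma> \<circ> \<tau>) = \<tau>" "\<sigma> \<circ> (inv \<sigma> \<circ> \<tau>) = \<tau>" for \<tau>
      using assms by (simp_all add: permutes_inv_o flip: o_assoc) (simp_all add: o_assoc permutes_inv_o)
  qed
  then show ?thesis
    unfolding trace_poly_def perm_act_sum perm_act_perm_act by (rule sum.reindex_bij_betw)
qed

lemma trace_monomial_invariant:
  assumes "is_multigraph n m"
  shows "trace_poly n (single m 1) \<in> (invariants n :: 'k::field edge_poly set)"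
  using keys_trace_monomial is_multigraph_graph_orbit[OF _ assms]
  unfolding invariants_def poly_ring_def by (fastforce simp: perm_act_trace)

section \<open>Benson's expansion and the degree bound\<close>

lemma prod_monomials:
  "(\<Prod>i\<in>I. single (f i) 1 :: 'k::field edge_poly) = single (\<Sum>i\<in>I. f i) 1"
  by (induction I rule: infinite_finite_induct) (auto simp: mult_single)

text \<open>Used with the group as index set, this supplies the family of variables for Benson's
  argument; the \<open>e i\<close> may repeat.\<close>

lemma split_off_edges:
  assumes "finite I" "card I \<le> num_edges m"
  shows "\<exists>e r. m = (\<Sum>i\<in>I. single (e i) 1) + r"
  using assms
proof (induction I rule: finite_induct)
  case (insert i I)
  then obtain e r where er: "m = (\<Sum>i\<in>I. single (e i) 1) + r" by auto
  then have "num_edges m = card I + num_edges r" by (simp add: num_edges_plus num_edges_sum)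
  then have "num_edges r > 0" using insert by simp
  then have "r \<noteq> 0" by auto
  then obtain k where k: "lookup r k \<noteq> 0" by (metis lookup_zero poly_mapping_eqI)
  \<comment> \<open>Truncated subtraction is exact here, since \<open>k\<close> has positive
    multiplicity in \<open>r\<close>.\<close>
  define r' where "r' = r - single k 1"
  have "r = single k 1 + r'"
    by (rule poly_mapping_eqI) (use k in \<open>auto simp: r'_def lookup_add lookup_minus lookup_single when_def\<close>)
  moreover have "(\<Sum>j\<in>I. single ((e(i := k)) j) 1) = (\<Sum>j\<in>I. single (e j) (1::nat))"
    using insert.hyps by (intro sum.cong) auto
  ultimately have "m = (\<Sum>j\<in>insert i I. single ((e(i := k)) j) 1) + r'"
    using er insert.hyps by (simp add: ac_simps)
  then show ?case by blast
qed auto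

lemma trace_expansion_zero:
  fixes x :: "(nat \<Rightarrow> nat) \<Rightarrow> 'k::field edge_poly"
  shows "(\<Sum>X\<in>Pow (perms n). trace_poly n (\<Prod>\<sigma>\<in>X. perm_act \<sigma> (x \<sigma>)) * (\<Prod>\<sigma>\<in>perms n - X. - x \<sigma>)) = 0"
proof -
  have zero: "(\<Sum>X\<in>Pow (perms n). perm_act \<tau> (\<Prod>\<sigma>\<in>X. perm_act \<sigma> (x \<sigma>)) * (\<Prod>\<sigma>\<in>perms n - X. - x \<sigma>)) = 0"
    if \<tau>: "\<tau> \<in> perms n" for \<tau>
  proof -
    have "inv \<tau> \<in> perms n" using \<tau> by (simp add: perms_def permutes_inv)
    moreover have "perm_act \<tau> (perm_act (inv \<tau>) p) = p" for p :: "'k edge_poly"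
      using \<tau> by (simp add: perms_def perm_act_perm_act permutes_inv_o)
        (simp add: perm_act_def sum_single_lookup)
    \<comment> \<open>The factor at \<open>inv \<tau>\<close> is
      \<open>x (inv \<tau>) - x (inv \<tau>)\<close>; \<open>prod_add\<close> then expands the
      vanishing product over subsets.\<close>
    ultimately have "(\<Prod>\<sigma>\<in>perms n. perm_act \<tau> (perm_act \<sigma> (x \<sigma>)) + - x \<sigma>) = 0"
      by (intro prod_zero finite_perms bexI[of _ "inv \<tau>"]) simp_all
    then show ?thesis
      unfolding perm_act_prod prod_add[OF finite_perms] .
  qed
  \<comment> \<open>The product over the complement of \<open>X\<close> does not involve
    \<open>\<tau>\<close>, so summing over \<open>\<tau>\<close> turns only the other factor into a
    trace.\<close>
  have "(\<Sum>X\<in>Pow (perms n). trace_poly n (\<Prod>\<sigma>\<in>X. perm_act \<sigma> (x \<sigma>)) * (\<Prod>\<sigma>\<in>perms n - X. - x \<sigma>)) =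
      (\<Sum>\<tau>\<in>perms n. \<Sum>X\<in>Pow (perms n). perm_act \<tau> (\<Prod>\<sigma>\<in>X. perm_act \<sigma> (x \<sigma>)) * (\<Prod>\<sigma>\<in>perms n - X. - x \<sigma>))"
    by (subst sum.swap) (simp add: trace_poly_def sum_distrib_right)
  then show ?thesis by (simp add: zero)
qed

text \<open>The bound is the group order \<open>r\<close>. Let \<open>B\<close> be generated by the
  invariants of degree at most \<open>r\<close>, and \<open>M\<close> be the \<open>B\<close>-module
  spanned by the monomials of degree below \<open>r\<close>. Every monomial lies in
  \<open>M\<close>, the trace maps \<open>M\<close> into \<open>B\<close>, and on invariants the
  trace is multiplication by the invertible number \<open>r\<close>.\<close>

lemma invariants_generated_in_bounded_degree:
  "\<exists>d. algebra_generated {p \<in> invariants n. \<forall>m\<in>keys p. num_edges m \<le> d} =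
    (invariants n :: 'k::field_char_0 edge_poly set)"
proof -
  define r where "r = card (perms n)"
  then have r_pos: "r > 0" using card_perms_pos by simp
  define B :: "'k edge_poly set" where
    "B = algebra_generated {p \<in> invariants n. \<forall>m\<in>keys p. num_edges m \<le> r}"
  have B_inv: "B \<subseteq> invariants n"
    unfolding B_def by (rule algebra_generated_minimal[OF _ invariants_is_subalgebra]) auto
  have B: "is_subalgebra B" unfolding B_def by (rule is_subalgebra_algebra_generated)
  then have B_sub: "edge_poly.subspace B" and B_mult: "\<And>p q. p \<in> B \<Longrightarrow> q \<in> B \<Longrightarrow> p * q \<in> B"
    by (auto simp: is_subalgebra_def)
  have trace_B: "trace_poly n (single m 1) \<in> B" if "is_multigraph n m" "num_edges m \<le> r" for m
    unfolding B_def using that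
    by (intro subsetD[OF algebra_generated_superset])
      (auto simp: trace_monomial_invariant num_edges_graph_orbit dest!: keys_trace_monomial)
  \<comment> \<open>Defined as a span over the field; \<open>M_mult\<close> shows that it is closed
    under multiplication by \<open>B\<close>.\<close>
  define M :: "'k edge_poly set" where
    "M = edge_poly.span {b * single m 1 | b m. b \<in> B \<and> is_multigraph n m \<and> num_edges m < r}"
  have M_sub: "edge_poly.subspace M" unfolding M_def by (rule edge_poly.subspace_span)
  have M_mult: "b * p \<in> M" if "b \<in> B" "p \<in> M" for b p
    using that(2) unfolding M_def
  proof (induction rule: edge_poly.span_induct_alt)
    case base
    then show ?case by (simp add: edge_poly.span_zero)
  next
    case (step c q p)
    then obtain b' m where "q = b' * single m 1" "b' \<in> B" "is_multigraph n m" "num_edges m < r" by blast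
    moreover from this have "b * b' * single m 1 \<in> {b * single m 1 | b m. b \<in> B \<and> is_multigraph n m \<and> num_edges m < r}"
      using B_mult that(1) by blast
    moreover have "b * (poly_scale c (b' * single m 1) + p) = poly_scale c (b * b' * single m 1) + b * p"
      by (simp add: poly_scale_def algebra_simps)
    ultimately show ?case
      using step.IH by (simp add: edge_poly.span_add edge_poly.span_scale edge_poly.span_base)
  qed
  have one_B: "(- 1) ^ k \<in> B" for k
    using B B_sub edge_poly.subspace_neg[OF B_sub, of 1] by (cases "even k") (auto simp: is_subalgebra_def)
  have monomial_M: "single m 1 \<in> M" if "is_multigraph n m" for m
    using that
  proof (induction "num_edges m" arbitrary: m rule: less_induct)
    case less
    show ?case
    proof (cases "num_edges m < r")
      case True
      have "1 \<in> B" using B by (simp add: is_subalgebra_def)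
      then have "1 * single m 1 \<in> M"
        unfolding M_def using True less.prems by (intro edge_poly.span_base) blast
      then show ?thesis by simp
    next
      case False
      then obtain e s where es: "m = (\<Sum>\<sigma>\<in>perms n. single (e \<sigma>) 1) + s"
        using split_off_edges[of "perms n" m] by (auto simp: r_def)
      then have e: "\<And>\<sigma>. \<sigma> \<in> perms n \<Longrightarrow> is_multigraph n (single (e \<sigma>) 1)" and s: "is_multigraph n s"
        using less.prems by (simp_all add: is_multigraph_plus is_multigraph_sum)
      define x :: "(nat \<Rightarrow> nat) \<Rightarrow> 'k edge_poly" where "x \<sigma> = single (single (e \<sigma>) 1) 1" for \<sigma>
      \<comment> \<open>The terms of the expansion, multiplied by the remainder \<open>s\<close>.
        The term of the empty set contains the whole monomial \<open>m\<close>.\<close>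
      define F where "F X = trace_poly n (\<Prod>\<sigma>\<in>X. perm_act \<sigma> (x \<sigma>)) * (\<Prod>\<sigma>\<in>perms n - X. - x \<sigma>) * single s 1" for X
      have monomial: "(\<Prod>\<sigma>\<in>Y. - x \<sigma>) * single s 1 = (- 1) ^ card Y * single ((\<Sum>\<sigma>\<in>Y. single (e \<sigma>) 1) + s) 1" for Y
        by (simp add: prod_uminus x_def prod_monomials mult_single mult.assoc)
      \<comment> \<open>For non-empty \<open>X\<close> the traced monomial has degree
        \<open>card X\<close>, at most \<open>r\<close>, so its trace lies in \<open>B\<close>; the
        monomial that remains has lost \<open>card X\<close> variables and is covered by
        induction.\<close>
      have F_M: "F X \<in> M" if X: "X \<in> Pow (perms n) - {{}}" for X
      proof -
        have "finite X" using X by (auto intro: finite_subset)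
        have yX: "(\<Prod>\<sigma>\<in>X. perm_act \<sigma> (x \<sigma>)) = single (\<Sum>\<sigma>\<in>X. single (\<sigma> ` e \<sigma>) 1) 1"
          by (simp add: x_def perm_act_single prod_monomials)
        have "is_multigraph n (single (\<sigma> ` e \<sigma>) 1)" if "\<sigma> \<in> X" for \<sigma>
          using is_multigraph_relabel[of \<sigma> n "single (e \<sigma>) 1"] e[of \<sigma>] that X by (auto simp: perms_def)
        then have "trace_poly n (\<Prod>\<sigma>\<in>X. perm_act \<sigma> (x \<sigma>)) \<in> B"
          unfolding yX using X \<open>finite X\<close>
          by (intro trace_B) (auto simp: is_multigraph_sum num_edges_sum r_def card_mono)
        then have "trace_poly n (\<Prod>\<sigma>\<in>X. perm_act \<sigma> (x \<sigma>)) * (- 1) ^ card (perms n - X) \<in> B"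
          using B_mult one_B by blast
        moreover have "single ((\<Sum>\<sigma>\<in>perms n - X. single (e \<sigma>) 1) + s) 1 \<in> M"
        proof (rule less.hyps)
          have "card (perms n - X) < card (perms n)"
            using X by (intro psubset_card_mono) auto
          then show "num_edges ((\<Sum>\<sigma>\<in>perms n - X. single (e \<sigma>) 1) + s) < num_edges m"
            by (simp add: es num_edges_plus num_edges_sum)
          show "is_multigraph n ((\<Sum>\<sigma>\<in>perms n - X. single (e \<sigma>) 1) + s)"
            using e s by (simp add: is_multigraph_plus is_multigraph_sum)
        qed
        ultimately have "trace_poly n (\<Prod>\<sigma>\<in>X. perm_act \<sigma> (x \<sigma>)) * (- 1) ^ card (perms n - X) *
            single ((\<Sum>\<sigma>\<in>perms n - X. single (e \<sigma>) 1) + s) 1 \<in> M"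
          by (rule M_mult)
        then show ?thesis unfolding F_def mult.assoc monomial .
      qed
      have "(\<Sum>X\<in>Pow (perms n). F X) = 0"
        using trace_expansion_zero[of n x] by (simp add: F_def flip: sum_distrib_right)
      then have "F {} = - (\<Sum>X\<in>Pow (perms n) - {{}}. F X)"
        by (simp add: sum.remove[of "Pow (perms n)" "{}"] eq_neg_iff_add_eq_0)
      then have "F {} \<in> M"
        using F_M by (auto intro!: edge_poly.subspace_neg[OF M_sub] edge_poly.subspace_sum[OF M_sub])
      then have "(- 1) ^ r * F {} \<in> M" using M_mult one_B by blast
      \<comment> \<open>The trace of the empty product 1 is \<open>r\<close>, and the sign comes
        from the \<open>r\<close> factors \<open>- x \<sigma>\<close>. Multiplying by the same sign
        again removes it.\<close>
      moreover have "F {} = of_nat r * ((- 1) ^ r * single m 1)"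
        using monomial[of "perms n"] by (simp add: F_def mult.assoc r_def es trace_poly_def)
      then have "(- 1) ^ r * F {} = ((- 1) * (- 1)) ^ r * (of_nat r * single m 1)"
        unfolding power_mult_distrib by (simp only: ac_simps)
      then have "(- 1) ^ r * F {} = poly_scale (of_nat r) (single m 1)"
        by (simp add: poly_scale_def)
      ultimately have "poly_scale (inverse (of_nat r)) (poly_scale (of_nat r) (single m 1)) \<in> M"
        by (simp only: edge_poly.subspace_scale[OF M_sub])
      then show ?thesis using r_pos by simp
    qed
  qed
  \<comment> \<open>For an invariant \<open>b\<close>, the trace of \<open>b * single m 1\<close> is
    \<open>b\<close> times the trace of a monomial of degree below \<open>r\<close>.\<close>
  have trace_M: "trace_poly n p \<in> B" if "p \<in> M" for p
    using that unfolding M_def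
  proof (induction rule: edge_poly.span_induct_alt)
    case base
    show ?case using edge_poly.subspace_0[OF B_sub] by (simp add: trace_poly_def)
  next
    case (step c q p)
    then obtain b m where "q = b * single m 1" "b \<in> B" "is_multigraph n m" "num_edges m < r" by blast
    then have "trace_poly n q \<in> B"
      using B_inv B_mult trace_B by (auto simp: trace_poly_invariant_mult)
    then show ?case
      using step.IH B_sub
      by (simp add: trace_poly_add trace_poly_scale edge_poly.subspace_add edge_poly.subspace_scale)
  qed
  have "p \<in> B" if p: "p \<in> invariants n" for p
  proof -
    have "p = (\<Sum>m\<in>keys p. poly_scale (lookup p m) (single m 1))"
      by (simp add: poly_scale_def mult_single sum_single_lookup)
    also have "\<dots> \<in> M"
      using p monomial_M
      by (intro edge_poly.subspace_sum[OF M_sub] edge_poly.subspace_scale[OF M_sub])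
        (auto simp: invariants_def poly_ring_def)
    finally have "trace_poly n p \<in> B" by (rule trace_M)
    then have "poly_scale (inverse (of_nat r)) (poly_scale (of_nat r) p) \<in> B"
      unfolding trace_poly_invariant[OF p] r_def by (rule edge_poly.subspace_scale[OF B_sub])
    then show ?thesis using r_pos by simp
  qed
  then have "B = invariants n" using B_inv by blast
  then show ?thesis unfolding B_def by blast
qed

theorem proposition2p1:
  fixes n :: nat
  assumes "n > 0"
  shows "(\<forall>d. edge_poly.independent (orbit_sum_products n d :: 'k::field_char_0 edge_poly set) \<and>
             edge_poly.span (orbit_sum_products n d :: 'k edge_poly set) =
               homogeneous_component d (invariants n)) \<and>
         algebra_generated {orbit_sum n g | g. is_multigraph n g \<and> quasi_connected n g \<and>
               num_edges g \<le> generation_degree (invariants n :: 'k edge_poly set)} =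
           (invariants n :: 'k edge_poly set)"
proof (intro conjI allI)
  show "edge_poly.independent (orbit_sum_products n d :: 'k edge_poly set)" for d
    by (rule independent_orbit_sum_products)
  show "edge_poly.span (orbit_sum_products n d :: 'k edge_poly set) =
      homogeneous_component d (invariants n)" for d
    by (rule span_orbit_sum_products)
  define \<beta> where "\<beta> = generation_degree (invariants n :: 'k edge_poly set)"
  let ?A = "algebra_generated {orbit_sum n g | g. is_multigraph n g \<and> quasi_connected n g \<and> num_edges g \<le> \<beta>}
      :: 'k edge_poly set"
  \<comment> \<open>Noether's bound provides a degree that works, so the \<open>LEAST\<close> in
    \<open>generation_degree\<close> is attained.\<close>
  have \<beta>: "algebra_generated {p \<in> invariants n. \<forall>m\<in>keys p. num_edges m \<le> \<beta>} =
      (invariants n :: 'k edge_poly set)"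
    unfolding \<beta>_def generation_degree_def
    by (rule LeastI_ex) (rule invariants_generated_in_bounded_degree)
  have A: "is_subalgebra ?A" by (rule is_subalgebra_algebra_generated)
  have "{p \<in> invariants n. \<forall>m\<in>keys p. num_edges m \<le> \<beta>} \<subseteq> ?A"
  proof safe
    fix p :: "'k edge_poly"
    assume p: "p \<in> invariants n" "\<forall>m\<in>keys p. num_edges m \<le> \<beta>"
    \<comment> \<open>A generator \<open>p\<close> may be inhomogeneous, so each of its monomials is
      treated in its own degree, which is at most \<open>\<beta>\<close>.\<close>
    have "orbit_sum n ` keys p \<subseteq> ?A"
    proof safe
      fix m assume m: "m \<in> keys p"
      then have "is_multigraph n m" using p(1) by (auto simp: invariants_def poly_ring_def)
      then have "orbit_sum n m \<in> edge_poly.span (orbit_sum_products n (num_edges m) :: 'k edge_poly set)"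
        by (rule orbit_sum_in_span_products)
      also have "\<dots> \<subseteq> ?A"
        using m p(2) A by (intro edge_poly.span_minimal orbit_sum_products_in_algebra) (auto simp: is_subalgebra_def)
      finally show "orbit_sum n m \<in> ?A" .
    qed
    then have "edge_poly.span (orbit_sum n ` keys p) \<subseteq> ?A"
      using A by (intro edge_poly.span_minimal) (auto simp: is_subalgebra_def)
    then show "p \<in> ?A" using invariant_in_span_orbit_sums[OF p(1)] by blast
  qed
  then have "invariants n \<subseteq> ?A" using \<beta> A algebra_generated_minimal by blast
  moreover have "?A \<subseteq> invariants n"
    by (rule algebra_generated_minimal[OF _ invariants_is_subalgebra]) (auto simp: orbit_sum_invariant)
  ultimately show "?A = invariants n" by blast
qed

end
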